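(* Let $n,m\ge1$ be integers, $\tau>0$, and let $\Sigma_0\in\mathbb{R}^{n\times n}$ be a symmetric matrix with $n$ distinct, positive eigenvalues. Let $\Sigma_0=\Omega\Lambda\Omega^\top$ be a spectral decomposition with $\Omega$ orthogonal and $\Lambda=\mathrm{Diag}(\lambda_1,\dots,\lambda_n)$, eigenvalues ordered decreasingly. Let $k\in\{1,\dots,\min\{n,m\}\}$. A point $W^*\in\mathcal{M}(k)$ is a critical point of $L^1_\tau|_{\mathcal{M}(k)}$ if and only if $$W^*=\Omega_{\mathcal{J}_k}(\bar\Lambda_{\mathcal{J}_k}-\tau I_k)^{1/2}V^\top$$ for some $\mathcal{J}_k\subseteq\{1,\dots,n\}$ with $|\mathcal{J}_k|=k$ and some $V\in\mathbb{R}^{m\times k}$ with $V^\top V=I_k$. (For this expression to define a critical point one must have $\tau\leqslant\lambda_j$ for all $j\in\mathcal{J}_k$, since the eigenvalues of $\bar\Lambda_{\mathcal{J}_k}-\tau I_k$ have to be nonnegative.) Moreover, the value at such a point is $$L^1_\tau(W^* )=\sum_{j\notin\mathcal{J}_k}(\sqrt{\lambda_j}-\sqrt{\tau})^2.$$ The minimum of $L^1_\tau$ over $\mathcal{M}(\leqslant k)$ is therefore attained precisely when $\mathcal{J}_k=\{1,\dots,k\}$. In particular, $\inf_{W\in\mathcal{M}(k)}L^1_\tau(W)=\min_{W\in\mathcal{M}(k)}L^1_\tau(W)$ and $\min_{W\in\mathcal{M}(k)}L^1_\tau(W)=\min_{W\in\mathcal{M}(\leqslant k)}L^1_\tau(W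)$.
   Context: The perturbed loss is $L^1_\tau:\mathbb{R}^{n\times m}\to\mathbb{R}$, $L^1_\tau(W)=\operatorname{tr}\big(WW^\top+\tau I_n+\Sigma_0-2(\Sigma_0^{1/2}(WW^\top+\tau I_n)\Sigma_0^{1/2})^{1/2}\big)$. $\mathcal{M}(k)$ is the set of real $n\times m$ matrices of rank exactly $k$, a smooth embedded submanifold of $\mathbb{R}^{n\times m}$; $\mathcal{M}(\leqslant k)$ is the set of real $n\times m$ matrices of rank at most $k$. $W\in\mathcal{M}(k)$ is a critical point of $L^1_\tau|_{\mathcal{M}(k)}$ if the differential of the restriction of $L^1_\tau$ to $\mathcal{M}(k)$ vanishes at $W$. For an index set $\mathcal{J}_k$ with $k$ elements, $\Omega_{\mathcal{J}_k}\in\mathbb{R}^{n\times k}$ is the submatrix of columns of $\Omega$ with index in $\mathcal{J}_k$, and $\bar\Lambda_{\mathcal{J}_k}\in\mathbb{R}^{k\times k}$ is the diagonal submatrix of $\Lambda$ with rows and columns indexed by $\mathcal{J}_k$.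
   Formalization: The minimum over M(k) is claimed attained only if τ < λ_k (for τ ≥ λ_k it is not, e.g. n=m=k=1, λ_1=τ), and the minimisers over M(≤k) are described via J_k={1,…,k} only if τ ≤ λ_k, since otherwise that expression does not exist; inf over M(k) = min over M(≤k) is shown for all τ > 0. *)

theory Defs
  imports "HOL-Analysis.Analysis"
begin

text \<open>
  An $n \times m$ real matrix has type \<open>real^'m^'n\<close>.  The index types \<open>'n\<close> and \<open>'k\<close> are finite
  linear orders and play the roles of $\{1,\dots,n\}$ and $\{1,\dots,k\}$.  The
  dummy sort in \<open>real^'n::_\<close> only stops the vector syntax from forcing the sort \<open>finite\<close>.
\<close>

definition eigenvalues :: "real^'n^'n \<Rightarrow> real set" where
  "eigenvalues A = {\<mu>. \<exists>v. v \<noteq> 0 \<and> A *v v = \<mu> *s v}"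

definition psd :: "real^'n^'n \<Rightarrow> bool" where
  "psd A \<longleftrightarrow> transpose A = A \<and> (\<forall>v. 0 \<le> v \<bullet> (A *v v))"

text \<open>The matrix power $A^{1/2}$; a meaningful value only for \<^term>\<open>psd A\<close>.\<close>
definition msqrt :: "real^'n^'n \<Rightarrow> real^'n^'n" where
  "msqrt A = (THE B. psd B \<and> B ** B = A)"

definition diag :: "real^'n \<Rightarrow> real^'n^'n" where
  "diag d = (\<chi> i j. if i = j then d $ i else 0)"

text \<open>Here \<open>mat \<tau>\<close> is $\tau I_n$.\<close>
definition L1 :: "real \<Rightarrow> real^'n^'n \<Rightarrow> real^'m^'n \<Rightarrow> real" where
  "L1 \<tau> \<Sigma>\<^sub>0 W =
     trace (W ** transpose W + mat \<tau> + \<Sigma>\<^sub>0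
       - 2 *\<^sub>R msqrt (msqrt \<Sigma>\<^sub>0 ** (W ** transpose W + mat \<tau>) ** msqrt \<Sigma>\<^sub>0))"

definition fixed_rank :: "nat \<Rightarrow> (real^'m^'n) set" where
  "fixed_rank k = {W. rank W = k}"

definition bounded_rank :: "nat \<Rightarrow> (real^'m^'n) set" where
  "bounded_rank k = {W. rank W \<le> k}"

text \<open>
  The differential at \<open>x\<close> of the restriction of \<open>f\<close> to an embedded submanifold \<open>M\<close>: tangent vectors
  are the velocities of curves in \<open>M\<close> through \<open>x\<close>, and the differential sends the velocity
  of \<open>\<gamma>\<close> to the derivative of \<open>f \<circ> \<gamma>\<close>.
\<close>
definition curve_in :: "'a::real_normed_vector set \<Rightarrow> 'a \<Rightarrow> 'a \<Rightarrow> (real \<Rightarrow> 'a) \<Rightarrow> bool" where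
  "curve_in M x v \<gamma> \<longleftrightarrow>
     (\<exists>e>0. \<gamma> C1_differentiable_on {-e<..<e} \<and> \<gamma> ` {-e<..<e} \<subseteq> M)
     \<and> \<gamma> 0 = x \<and> (\<gamma> has_vector_derivative v) (at 0)"

definition has_differential_on ::
  "('a::real_normed_vector \<Rightarrow> real) \<Rightarrow> 'a set \<Rightarrow> 'a \<Rightarrow> ('a \<Rightarrow> real) \<Rightarrow> bool" where
  "has_differential_on f M x D \<longleftrightarrow>
     (\<forall>v \<gamma>. curve_in M x v \<gamma> \<longrightarrow> ((f \<circ> \<gamma>) has_real_derivative D v) (at 0))"

definition critical_point_on :: "('a::real_normed_vector \<Rightarrow> real) \<Rightarrow> 'a set \<Rightarrow> 'a \<Rightarrow> bool" where
  "critical_point_on f M x \<longleftrightarrow> x \<in> M \<and> has_differential_on f M x (\<lambda>v. 0)"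

text \<open>The increasing enumeration of an index set with \<^term>\<open>CARD('k)\<close> elements.\<close>
definition enum_set :: "'n::{finite,linorder} set \<Rightarrow> 'k::{finite,linorder} \<Rightarrow> 'n" where
  "enum_set J = (THE e. strict_mono e \<and> range e = J)"

definition cols :: "real^'n::{finite,linorder}^'n::_ \<Rightarrow> 'n set \<Rightarrow> real^'k::{finite,linorder}^'n::_" where
  "cols A J = (\<chi> i b. A $ i $ enum_set J b)"

definition principal_submatrix ::
  "real^'n::{finite,linorder}^'n::_ \<Rightarrow> 'n set \<Rightarrow> real^'k::{finite,linorder}^'k::_" where
  "principal_submatrix A J = (\<chi> a b. A $ enum_set J a $ enum_set J b)"

definition spectral_point ::
  "real \<Rightarrow> real^'n::{finite,linorder}^'n::_ \<Rightarrow> real^'n::_^'n::_ \<Rightarrow> 'n set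
     \<Rightarrow> real^'k::{finite,linorder}^'m \<Rightarrow> real^'m^'n::_" where
  "spectral_point \<tau> \<Omega> \<Lambda> J V =
     cols \<Omega> J ** msqrt (principal_submatrix \<Lambda> J - mat \<tau>) ** transpose V"

text \<open>The data \<open>(J, V)\<close> for which \<^const>\<open>spectral_point\<close> is the intended real matrix: the square
  root in it exists exactly when \<open>\<tau> \<le> lam $ j\<close> for all \<open>j \<in> J\<close>.\<close>
definition admissible ::
  "real \<Rightarrow> real^'n::{finite,linorder} \<Rightarrow> 'n set \<Rightarrow> real^'k::{finite,linorder}^'m \<Rightarrow> bool" where
  "admissible \<tau> lam J V \<longleftrightarrow>
     card J = CARD('k) \<and> (\<forall>j\<in>J. \<tau> \<le> lam $ j) \<and> transpose V ** V = mat 1"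

text \<open>The set $\{1,\dots,k\}$ inside the ordered index type.\<close>
definition first_indices :: "nat \<Rightarrow> 'n::{finite,linorder} set" where
  "first_indices k = {i. card {..i} \<le> k}"

end

theory Submission
  imports Defs
begin

text \<open>
  Write $A = \Sigma_0^{1/2}$, $S = WW^\top + \tau I$ and $X = (ASA)^{1/2}$.  If $Y$ is another
  positive definite root and $E = X - Y$, then
  $\operatorname{tr} X = \operatorname{tr} Y + \frac12\operatorname{tr} Y^{-1}(X^2 - Y^2)
  - \frac12\operatorname{tr} Y^{-1}E^2$, and $\|E\| \le C\|X^2 - Y^2\|$.  Hence $L^1_\tau$ is
  differentiable with gradient $2(I - P)W$, where $P = AX^{-1}A$ is characterised by
  $PSP = \Sigma_0$.  The curves $(I + tK)W$ have constant rank, so $W$ is critical on its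
  fixed-rank manifold iff $PW = W$.  With $M = WW^\top$ this turns $PSP = \Sigma_0$ into
  $\Sigma_0 M = M^2 + \tau M$; thus $M$ commutes with $\Sigma_0$, is diagonal in the same basis, and
  its eigenvalues are $0$ or $\lambda_j - \tau$.

  A minimiser over rank at most $k$ exists by coercivity, and it is critical on the manifold
  of its own rank, because $(I + tK)W$ never has larger rank than $W$.  So the minimisation
  reduces to choosing the index set that maximises $\sum_{j \in J} (\sqrt{\lambda_j} - \sqrt\tau)^2$
  among those with at most $k$ elements and $\lambda_j > \tau$.
\<close>

text \<open>\<open>msqrt\<close> is a definite description, and no formula for the root is at hand
  when W W^T and \<open>\<Sigma>\<^sub>0\<close> do not commute. Two facts avoid differentiating it:
  the loss needs only the trace of the root, whose expansion is exact, and a positive definite root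
  is Lipschitz against any other psd root, so the remainder is quadratic. Roots are evaluated only
  when W W^T commutes with \<open>\<Sigma>\<^sub>0\<close>, where everything becomes scalar. Two
  degenerate cases shape the statements. If lam_j = \<tau> for some j in J, that index contributes a
  zero eigenvalue: the spectral point has rank below |J| and one column of V is not determined by
  the matrix. If lam_j <= \<tau> for one of the first k indices, every minimiser over rank at most k
  has rank below k, and its value is only approached within rank exactly k. Hence equality of the
  infimum is unconditional, while attainment asks for \<tau> < lam_j on the first k indices.\<close>

lemma matrix_add_rdistrib: "((A + B) ** C) = (A ** C) + (B ** C)" for A B :: "real^'m^'n"
  by (vector matrix_matrix_mult_def sum.distrib[symmetric] field_simps)

lemma bounded_bilinear_matrix_mult:
  "bounded_bilinear ((**) :: real^'m^'n \<Rightarrow> real^'k^'m \<Rightarrow> real^'k^'n)"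
  unfolding bilinear_conv_bounded_bilinear[symmetric] bilinear_def
  by (auto intro!: linearI simp: matrix_add_ldistrib matrix_add_rdistrib scalar_matrix_assoc
      matrix_scalar_ac)

lemma bounded_linear_transpose: "bounded_linear (transpose :: real^'m^'n \<Rightarrow> real^'n^'m)"
  unfolding linear_conv_bounded_linear[symmetric]
  by (auto intro!: linearI simp: transpose_def vec_eq_iff)

lemma bounded_linear_trace: "bounded_linear (trace :: real^'n^'n \<Rightarrow> real)"
  unfolding linear_conv_bounded_linear[symmetric]
  by (auto intro!: linearI simp: trace_def sum.distrib sum_distrib_left)

lemmas transpose_add = linear_add[OF bounded_linear.linear[OF bounded_linear_transpose]]
lemmas transpose_diff = linear_diff[OF bounded_linear.linear[OF bounded_linear_transpose]]
lemmas matrix_mult_diff_left = bounded_bilinear.diff_left[OF bounded_bilinear_matrix_mult]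
lemmas matrix_mult_diff_right = bounded_bilinear.diff_right[OF bounded_bilinear_matrix_mult]
lemmas trace_scaleR = linear_scale[OF bounded_linear.linear[OF bounded_linear_trace]]
lemmas matrix_mult_scaleR_left = bounded_bilinear.scaleR_left[OF bounded_bilinear_matrix_mult]
lemmas matrix_mult_scaleR_right = bounded_bilinear.scaleR_right[OF bounded_bilinear_matrix_mult]

lemmas mat_algebra = matrix_add_ldistrib matrix_add_rdistrib matrix_mult_diff_left matrix_mult_diff_right
  matrix_mult_scaleR_left matrix_mult_scaleR_right trace_add trace_sub trace_scaleR
  transpose_add transpose_diff matrix_transpose_mul matrix_mul_assoc

lemma matrix_vector_mul_mat: "mat c *v v = c *\<^sub>R v" for v :: "real^'n"
  by (simp add: vec_eq_iff mat_def matrix_vector_mult_def if_distrib[of "\<lambda>x. x * _"] cong: if_cong)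

lemma mat_eq_scaleR: "mat c = c *\<^sub>R (mat 1 :: real^'n^'n)"
  by (simp add: mat_def vec_eq_iff)

lemma inner_matrix: "A \<bullet> B = trace (transpose A ** B)" for A B :: "real^'m^'n"
  unfolding inner_vec_def trace_def matrix_matrix_mult_def transpose_def
  by (simp, rule sum.swap)

lemma symmetric_inner:
  fixes A :: "real^'n^'n"
  assumes "transpose A = A"
  shows "(A *v x) \<bullet> y = x \<bullet> (A *v y)"
  by (metis assms dot_lmul_matrix transpose_matrix_vector)

lemma transpose_eqI_inner:
  fixes A :: "real^'n^'n"
  assumes "\<And>x y. (A *v x) \<bullet> y = x \<bullet> (A *v y)"
  shows "transpose A = A"
proof -
  have "transpose A *v x = A *v x" for x
    by (rule vector_eq_ldot[THEN iffD1]) 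
      (metis assms dot_lmul_matrix transpose_matrix_vector inner_commute)
  then show ?thesis by (simp add: matrix_eq)
qed

subsection \<open>Positive semidefinite matrices and their square roots\<close>

text \<open>With q the quadratic form of \<open>A\<close>, the function t -> q(u + t w) equals 2ta +
  t^2 b. It is nonnegative and vanishes at t = 0, so its linear coefficient a is zero. The
  restriction to a subspace is what the induction for eigenbases uses.\<close>

lemma nonneg_form_zero_orthogonal:
  fixes A :: "real^'n^'n"
  assumes sym: "transpose A = A" and U: "subspace U" "u \<in> U" "w \<in> U"
    and nonneg: "\<And>v. v \<in> U \<Longrightarrow> 0 \<le> v \<bullet> (A *v v)"
    and zero: "u \<bullet> (A *v u) = 0"
  shows "w \<bullet> (A *v u) = 0"
proof (rule ccontr)
  assume nz: "w \<bullet> (A *v u) \<noteq> 0"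
  define a where "a = w \<bullet> (A *v u)"
  define b where "b = w \<bullet> (A *v w)"
  have sw: "u \<bullet> (A *v w) = a"
    unfolding a_def by (metis sym symmetric_inner inner_commute)
  have q: "0 \<le> 2 * t * a + t^2 * b" for t
  proof -
    have "u + t *\<^sub>R w \<in> U" using U by (simp add: subspace_add subspace_scale)
    from nonneg[OF this] have "0 \<le> (u + t *\<^sub>R w) \<bullet> (A *v u + t *\<^sub>R (A *v w))"
      by (simp only: matrix_vector_right_distrib matrix_vector_mult_scaleR)
    also have "\<dots> = 2 * t * a + t^2 * b"
      by (simp add: inner_add_left inner_add_right sw zero power2_eq_square a_def[symmetric] b_def[symmetric])
        (simp add: algebra_simps)
    finally show ?thesis .
  qed
  have b0: "0 \<le> b" unfolding b_def by (rule nonneg[OF U(3)])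
  \<comment> \<open>The minimiser would be -a/b; the denominator b + 1 also covers b = 0 and still
    makes the value negative unless a = 0.\<close>
  define s where "s = - a / (b + 1)"
  have "a = - s * (b + 1)" using b0 by (simp add: s_def)
  then have "2 * s * a + s^2 * b = - (s^2 * (b + 2))" by algebra
  with q[of s] have "s^2 * (b + 2) \<le> 0" by simp
  moreover have "0 \<le> s^2 * (b + 2)" using b0 by simp
  ultimately have "s = 0" using b0 by simp
  with \<open>a = - s * (b + 1)\<close> have "a = 0" by simp
  with nz show False by (simp only: a_def)
qed

lemma psd_form_zero:
  assumes "psd A" "v \<bullet> (A *v v) = 0"
  shows "A *v v = 0"
proof -
  have "(A *v v) \<bullet> (A *v v) = 0"
    using assms nonneg_form_zero_orthogonal[of A UNIV v "A *v v"] by (simp add: psd_def)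
  then show ?thesis by simp
qed

text \<open>A maximiser u of the Rayleigh quotient on the unit sphere of \<open>U\<close> is an
  eigenvector: \<mu> I - A is nonnegative on \<open>U\<close> and its form vanishes at u, so (\<mu>
  I - A) u, which lies in \<open>U\<close> by invariance, is orthogonal to itself. The complement of
  u in \<open>U\<close> is again invariant, which drives the induction on the dimension.\<close>

lemma symmetric_eigenbasis:
  fixes A :: "real^'n^'n"
  assumes sym: "transpose A = A"
    and "subspace U" "\<And>v. v \<in> U \<Longrightarrow> A *v v \<in> U"
  shows "\<exists>B. B \<subseteq> U \<and> pairwise orthogonal B \<and> (\<forall>b\<in>B. norm b = 1 \<and> (\<exists>\<mu>. A *v b = \<mu> *\<^sub>R b)) \<and> U \<subseteq> span B"
  using assms(2,3)
proof (induction "dim U" arbitrary: U rule: less_induct)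
  case less
  show ?case
  proof (cases "U \<subseteq> {0}")
    case True
    then show ?thesis by (intro exI[of _ "{}"]) auto
  next
    case False
    then obtain v0 where v0: "v0 \<in> U" "v0 \<noteq> 0" by auto
    let ?S = "sphere 0 1 \<inter> U"
    have "v0 /\<^sub>R norm v0 \<in> ?S" using v0 less.prems(1) by (auto simp: subspace_scale)
    then have ne: "?S \<noteq> {}" by blast
    have comp: "compact ?S" using less.prems(1) by (simp add: closed_subspace compact_Int_closed)
    have "continuous_on ?S (\<lambda>v. v \<bullet> (A *v v))" by (intro continuous_intros)
    from continuous_attains_sup[OF comp ne this] obtain u where
      u: "u \<in> U" "norm u = 1" and umax: "\<And>v. v \<in> U \<Longrightarrow> norm v = 1 \<Longrightarrow> v \<bullet> (A *v v) \<le> u \<bullet> (A *v u)"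
      by auto
    define \<mu> where "\<mu> = u \<bullet> (A *v u)"
    define M where "M = mat \<mu> - A"
    have Mv: "M *v v = \<mu> *\<^sub>R v - A *v v" for v
      by (simp add: M_def matrix_vector_mult_diff_rdistrib matrix_vector_mul_mat)
    have Msym: "transpose M = M" by (simp add: M_def transpose_diff sym)
    have Mnn: "0 \<le> v \<bullet> (M *v v)" if "v \<in> U" for v
    proof (cases "v = 0")
      case False
      let ?w = "v /\<^sub>R norm v"
      have w: "?w \<in> U" "norm ?w = 1" using that False less.prems(1) by (auto simp: subspace_scale)
      have "v \<bullet> (A *v v) = (norm v)^2 * (?w \<bullet> (A *v ?w))"
        using False by (simp add: matrix_vector_mult_scaleR power2_eq_square divide_simps)
      also have "\<dots> \<le> (norm v)^2 * \<mu>"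
        unfolding \<mu>_def by (intro mult_left_mono umax w) auto
      finally show ?thesis by (simp add: Mv inner_diff_right dot_square_norm mult.commute)
    qed simp
    have Mu: "u \<bullet> (M *v u) = 0" using u by (simp add: Mv inner_diff_right dot_square_norm \<mu>_def)
    have MuU: "M *v u \<in> U" using less.prems u by (simp add: Mv subspace_diff subspace_scale)
    have "(M *v u) \<bullet> (M *v u) = 0"
      by (rule nonneg_form_zero_orthogonal[OF Msym less.prems(1) u(1) MuU Mnn Mu])
    then have Au: "A *v u = \<mu> *\<^sub>R u" by (simp add: Mv)
    let ?U = "U \<inter> {v. u \<bullet> v = 0}"
    have sub: "subspace ?U" by (rule subspace_inter[OF less.prems(1) subspace_hyperplane])
    have "?U \<subset> U" using u by (force simp: dot_square_norm)
    then have d: "dim ?U < dim U"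
      using sub less.prems(1) by (intro dim_psubset) (simp add: span_eq_iff[THEN iffD2])
    have inv: "A *v v \<in> ?U" if "v \<in> ?U" for v
      using that less.prems(2) symmetric_inner[OF sym, of u v] by (simp add: Au)
    from less.hyps[OF d sub inv] obtain B where B: "B \<subseteq> ?U" "pairwise orthogonal B"
      "\<forall>b\<in>B. norm b = 1 \<and> (\<exists>\<mu>. A *v b = \<mu> *\<^sub>R b)" "?U \<subseteq> span B" by blast
    have "v \<in> span (insert u B)" if "v \<in> U" for v
    proof -
      have "v - (u \<bullet> v) *\<^sub>R u \<in> ?U" 
        using that u less.prems(1) by (simp add: subspace_diff subspace_scale inner_diff_right dot_square_norm)
      with B(4) have "v - (u \<bullet> v) *\<^sub>R u \<in> span B" by blast
      then show ?thesis by (auto simp: span_insert)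
    qed
    moreover have "pairwise orthogonal (insert u B)"
      using B by (auto simp: pairwise_insert orthogonal_def inner_commute)
    ultimately show ?thesis using B u Au by (intro exI[of _ "insert u B"]) auto
  qed
qed

text \<open>Scale each vector of an orthonormal eigenbasis by the root of its eigenvalue; the square
  agrees with \<open>A\<close> on the basis, hence everywhere.\<close>

lemma psd_sqrt_exists:
  fixes A :: "real^'n^'n"
  assumes "psd A"
  shows "\<exists>X. psd X \<and> X ** X = A"
proof -
  have sym: "transpose A = A" using assms by (simp add: psd_def)
  obtain B where B: "pairwise orthogonal B" "\<And>b. b\<in>B \<Longrightarrow> norm b = 1"
      "\<And>b. b \<in> B \<Longrightarrow> \<exists>\<mu>. A *v b = \<mu> *\<^sub>R b" "span B = UNIV"
    using symmetric_eigenbasis[OF sym, of UNIV] by auto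
  define \<mu> where "\<mu> b = b \<bullet> (A *v b)" for b
  have Ab: "A *v b = \<mu> b *\<^sub>R b" if "b \<in> B" for b
    using B(2,3)[OF that] by (auto simp: \<mu>_def dot_square_norm)
  have mu0: "0 \<le> \<mu> b" for b using assms by (simp add: \<mu>_def psd_def)
  have fin: "finite B"
  proof -
    have "0 \<notin> B" using B(2)[of 0] by auto
    with B(1) show ?thesis by (intro independent_imp_finite pairwise_orthogonal_independent)
  qed
  define f where "f v = (\<Sum>b\<in>B. (sqrt (\<mu> b) * (b \<bullet> v)) *\<^sub>R b)" for v
  have lin: "linear f"
    unfolding f_def
    by (intro linearI)
      (simp_all add: inner_add_right distrib_left scaleR_add_left sum.distrib scaleR_sum_right mult_ac)
  define X where "X = matrix f"
  have Xv: "X *v v = f v" for v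
    using lin unfolding X_def by (metis matrix_vector_mul(2))
  have "(X *v x) \<bullet> y = x \<bullet> (X *v y)" for x y
    unfolding Xv f_def by (simp add: inner_sum_left inner_sum_right inner_commute mult_ac)
  then have Xsym: "transpose X = X" by (rule transpose_eqI_inner)
  have "v \<bullet> (X *v v) = (\<Sum>b\<in>B. sqrt (\<mu> b) * (b \<bullet> v)^2)" for v
    unfolding Xv f_def by (simp add: inner_sum_right inner_commute power2_eq_square mult_ac)
  then have "0 \<le> v \<bullet> (X *v v)" for v by (simp add: mu0 sum_nonneg)
  with Xsym have "psd X" by (simp add: psd_def)
  moreover have "X ** X = A"
  proof -
    have Xb: "X *v b = sqrt (\<mu> b) *\<^sub>R b" if "b \<in> B" for b
    proof -
      have "X *v b = (\<Sum>c\<in>B. if c = b then sqrt (\<mu> b) *\<^sub>R b else 0)"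
        unfolding Xv f_def using B(1,2) that
        by (intro sum.cong) (auto simp: dot_square_norm pairwise_def orthogonal_def)
      then show ?thesis using fin that by simp
    qed
    have "(X ** X) *v b = A *v b" if "b \<in> B" for b
      using mu0[of b] by (simp add: Xb Ab that matrix_vector_mult_scaleR flip: matrix_vector_mul_assoc)
    then have "(X ** X) *v v = A *v v" for v
      using linear_eq_on_span[of "(*v) (X ** X)" "(*v) A" B v] B(4) by (simp add: matrix_vector_mul_linear)
    then show ?thesis by (simp add: matrix_eq)
  qed
  ultimately show ?thesis by blast
qed

text \<open>Reduces matrix inequalities to inequalities for quadratic forms at the columns of
  \<open>E\<close>.\<close>

lemma trace_congruence:
  fixes E :: "real^'m^'n"
  shows "trace (transpose E ** X ** E) = (\<Sum>i\<in>UNIV. column i E \<bullet> (X *v column i E))"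
  unfolding matrix_mul_assoc[symmetric]
  by (simp add: trace_def matrix_matrix_mult_def transpose_def inner_vec_def column_def
      matrix_vector_mult_def)

lemma psd_trace_congruence_nonneg: "psd X \<Longrightarrow> 0 \<le> trace (transpose E ** X ** E)"
  unfolding trace_congruence by (intro sum_nonneg) (auto simp: psd_def)

text \<open>X^2 - Y^2 = XE + EY holds without commutation; pairing it with E gives the two traces.
  Uniqueness of the root and its Lipschitz bound both rest on this identity.\<close>

lemma trace_diff_squares:
  fixes X Y :: "real^'n^'n"
  assumes "transpose X = X" "transpose Y = Y"
  defines "E \<equiv> X - Y"
  shows "trace (transpose E ** X ** E) + trace (transpose E ** Y ** E) = E \<bullet> (X ** X - Y ** Y)"
proof -
  have Es: "transpose E = E" by (simp add: E_def transpose_diff assms)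
  have "E \<bullet> (X ** X - Y ** Y) = trace (E ** (X ** E + E ** Y))"
    by (simp add: inner_matrix Es) (simp add: E_def mat_algebra)
  also have "\<dots> = trace (E ** X ** E) + trace (E ** (E ** Y))" by (simp add: mat_algebra)
  also have "trace (E ** (E ** Y)) = trace (E ** Y ** E)" by (rule trace_mul_sym)
  finally show ?thesis by (simp add: Es)
qed

text \<open>Both traces are nonnegative and sum to zero, so \<open>X\<close> and \<open>Y\<close>
  annihilate every column of E. Then E annihilates its own columns, and E^2 = 0 forces E = 0 by
  symmetry.\<close>

lemma psd_sqrt_unique:
  fixes X Y :: "real^'n^'n"
  assumes "psd X" "psd Y" "X ** X = Y ** Y"
  shows "X = Y"
proof -
  define E where "E = X - Y"
  have sym: "transpose X = X" "transpose Y = Y" using assms by (auto simp: psd_def)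
  have Esym: "transpose E = E" by (simp add: E_def transpose_diff sym)
  have "trace (transpose E ** X ** E) + trace (transpose E ** Y ** E) = 0"
    using trace_diff_squares[OF sym] assms(3) by (simp add: E_def)
  then have z: "trace (transpose E ** X ** E) = 0" "trace (transpose E ** Y ** E) = 0"
    using psd_trace_congruence_nonneg assms(1,2) add_nonneg_eq_0_iff by metis+
  have "column i E = 0" for i
  proof -
    let ?c = "column i E"
    have "?c \<bullet> (X *v ?c) = 0" "?c \<bullet> (Y *v ?c) = 0"
      using z assms(1,2) unfolding trace_congruence
      by (subst (asm) sum_nonneg_eq_0_iff; auto simp: psd_def)+
    then have "E *v ?c = 0"
      using psd_form_zero[OF assms(1), of ?c] psd_form_zero[OF assms(2), of ?c]
      by (simp add: E_def[symmetric]) (simp add: E_def matrix_vector_mult_diff_rdistrib)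
    moreover have "?c = E *v axis i 1"
      by (simp add: vec_eq_iff column_def matrix_vector_mul_component inner_axis)
    ultimately have "?c \<bullet> ?c = 0" 
      by (metis symmetric_inner[OF Esym] inner_zero_right)
    then show ?thesis by simp
  qed
  then have "E = 0" by (simp add: vec_eq_iff column_def)
  then show ?thesis by (simp add: E_def)
qed

lemma psd_msqrt:
  assumes "psd A"
  shows "psd (msqrt A)" "msqrt A ** msqrt A = A"
proof -
  have "\<exists>!X. psd X \<and> X ** X = A"
    using psd_sqrt_exists[OF assms] psd_sqrt_unique by metis
  from theI'[OF this] show "psd (msqrt A)" "msqrt A ** msqrt A = A" by (auto simp: msqrt_def)
qed

lemma msqrt_unique: "psd X \<Longrightarrow> X ** X = A \<Longrightarrow> msqrt A = X"
  unfolding msqrt_def using psd_sqrt_unique by (intro the_equality) auto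

text \<open>Compactness of the unit sphere provides a minimum c of the form; c = 0 would put a unit
  vector into the kernel.\<close>

lemma psd_invertible_lower_bound:
  fixes X :: "real^'n^'n"
  assumes "psd X" "Z ** X = mat 1"
  obtains c where "0 < c" "\<And>v. c * (v \<bullet> v) \<le> v \<bullet> (X *v v)"
proof -
  have ne: "sphere (0::real^'n) 1 \<noteq> {}" by simp
  have "continuous_on (sphere 0 1) (\<lambda>v. v \<bullet> (X *v v))" by (intro continuous_intros)
  from continuous_attains_inf[OF compact_sphere ne this] obtain u where
    u: "norm u = 1" and umin: "\<And>v. norm v = 1 \<Longrightarrow> u \<bullet> (X *v u) \<le> v \<bullet> (X *v v)"
    by auto
  let ?c = "u \<bullet> (X *v u)"
  have "?c \<noteq> 0"
  proof
    assume "?c = 0"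
    with assms(1) have "X *v u = 0" by (rule psd_form_zero)
    then have "(Z ** X) *v u = 0" by (simp flip: matrix_vector_mul_assoc)
    with assms(2) u show False by auto
  qed
  moreover have "0 \<le> ?c" using assms(1) by (simp add: psd_def)
  ultimately have c0: "0 < ?c" by simp
  have "?c * (v \<bullet> v) \<le> v \<bullet> (X *v v)" for v
  proof (cases "v = 0")
    case False
    let ?w = "v /\<^sub>R norm v"
    have "norm ?w = 1" using False by simp
    from mult_left_mono[OF umin[OF this], of "(norm v)^2"]
    have "?c * (v \<bullet> v) \<le> (norm v)^2 * (?w \<bullet> (X *v ?w))"
      by (simp only: mult.commute dot_square_norm) simp
    also have "\<dots> = v \<bullet> (X *v v)"
      using False by (simp add: matrix_vector_mult_scaleR power2_eq_square divide_simps)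
    finally show ?thesis .
  qed simp
  with c0 show ?thesis by (rule that)
qed

text \<open>Only \<open>X\<close> has to be bounded below; the trace with \<open>Y\<close> is
  dropped as nonnegative. The constant is thus uniform in \<open>Y\<close>, as differentiation at a
  fixed \<open>X\<close> requires.\<close>

lemma psd_sqrt_lipschitz:
  fixes X Y :: "real^'n^'n"
  assumes "psd X" "psd Y" and c: "\<And>v. c * (v \<bullet> v) \<le> v \<bullet> (X *v v)"
  shows "c * norm (X - Y) \<le> norm (X ** X - Y ** Y)"
proof (cases "X = Y")
  case False
  define E where "E = X - Y"
  have sym: "transpose X = X" "transpose Y = Y" using assms by (auto simp: psd_def)
  have "c * (E \<bullet> E) = c * trace (transpose E ** mat 1 ** E)" by (simp add: inner_matrix)
  also have "\<dots> = (\<Sum>i\<in>UNIV. c * (column i E \<bullet> column i E))"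
    by (simp only: trace_congruence sum_distrib_left matrix_vector_mul_lid)
  also have "\<dots> \<le> trace (transpose E ** X ** E)"
    unfolding trace_congruence by (intro sum_mono c)
  also have "\<dots> \<le> E \<bullet> (X ** X - Y ** Y)"
    using trace_diff_squares[OF sym] psd_trace_congruence_nonneg[OF assms(2), of E]
    by (simp add: E_def)
  also have "\<dots> \<le> norm E * norm (X ** X - Y ** Y)" by (rule norm_cauchy_schwarz)
  finally have "norm E * (c * norm E) \<le> norm E * norm (X ** X - Y ** Y)"
    by (simp add: dot_square_norm power2_eq_square mult_ac)
  with False show ?thesis by (simp add: E_def)
qed simp

text \<open>Since X^2 - Y^2 - E^2 = YE + EY, multiplying by the inverse \<open>Z\<close> of
  \<open>Y\<close> and taking traces gives twice the trace of E by cyclicity. The identity is exact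
  for every \<open>X\<close>, close to \<open>Y\<close> or not.\<close>

lemma trace_sqrt_expansion:
  fixes X Y Z :: "real^'n^'n"
  assumes Z: "Z ** Y = mat 1"
  shows "trace X = trace Y + trace (Z ** (X ** X - Y ** Y)) / 2 - trace (Z ** ((X - Y) ** (X - Y))) / 2"
proof -
  define E where "E = X - Y"
  have YZ: "Y ** Z = mat 1" using Z by (simp add: matrix_left_right_inverse)
  have "X ** X - Y ** Y - E ** E = Y ** E + E ** Y" by (simp add: E_def mat_algebra)
  then have "trace (Z ** (X ** X - Y ** Y)) - trace (Z ** (E ** E)) = trace (Z ** (Y ** E + E ** Y))"
    by (metis matrix_mult_diff_right trace_sub)
  also have "\<dots> = trace (Z ** Y ** E) + trace (Z ** E ** Y)" by (simp add: mat_algebra)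
  also have "trace (Z ** E ** Y) = trace (Y ** Z ** E)" by (metis trace_mul_sym matrix_mul_assoc)
  finally show ?thesis by (simp add: Z YZ) (simp add: E_def trace_sub)
qed

lemma has_derivative_zero_squeeze:
  fixes g h :: "'a::real_normed_vector \<Rightarrow> real"
  assumes h: "(h has_derivative (\<lambda>_. 0)) (at x)" "h x = 0" and g: "\<And>y. \<bar>g y\<bar> \<le> h y"
  shows "(g has_derivative (\<lambda>_. 0)) (at x)"
proof -
  have gx: "g x = 0" using g[of x] h(2) by simp
  have "((\<lambda>y. \<bar>h y\<bar> / norm (y - x)) \<longlongrightarrow> 0) (at x)"
    using h by (simp add: has_derivative_iff_norm)
  moreover have "\<bar>g y\<bar> \<le> \<bar>h y\<bar>" for y using g[of y] by simp
  ultimately have "((\<lambda>y. \<bar>g y\<bar> / norm (y - x)) \<longlongrightarrow> 0) (at x)"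
    by (elim Lim_null_comparison[rotated], intro always_eventually allI) (simp add: divide_right_mono)
  then show ?thesis by (simp add: has_derivative_iff_norm gx)
qed

lemma transpose_gram: "transpose (W ** transpose W) = W ** transpose W" for W :: "real^'m^'n"
  by (simp add: matrix_transpose_mul)

lemma gram_form: "v \<bullet> ((W ** transpose W) *v v) = (transpose W *v v) \<bullet> (transpose W *v v)"
  for W :: "real^'m^'n"
  by (simp add: dot_lmul_matrix flip: matrix_vector_mul_assoc) 

subsection \<open>The differential of the perturbed loss\<close>

locale perturbed_bures =
  fixes \<tau> :: real and \<Sigma>\<^sub>0 :: "real^'n^'n"
  assumes tau_pos: "0 < \<tau>"
    and psd_Sigma: "psd \<Sigma>\<^sub>0"
    and inj_Sigma: "\<And>v. \<Sigma>\<^sub>0 *v v = 0 \<Longrightarrow> v = 0"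
begin

definition A :: "real^'n^'n" where "A = msqrt \<Sigma>\<^sub>0"
definition S :: "real^'m^'n \<Rightarrow> real^'n^'n" where "S W = W ** transpose W + mat \<tau>"
definition X :: "real^'m^'n \<Rightarrow> real^'n^'n" where "X W = msqrt (A ** S W ** A)"
text \<open>The linear optimal transport map between the centred Gaussians with covariances
  \<open>S W\<close> and \<open>\<Sigma>\<^sub>0\<close>.\<close>

definition P :: "real^'m^'n \<Rightarrow> real^'n^'n" where "P W = A ** matrix_inv (X W) ** A"

lemma A_sym: "transpose A = A" and AA: "A ** A = \<Sigma>\<^sub>0"
  using psd_msqrt[OF psd_Sigma] by (auto simp: A_def psd_def)

lemma S_sym: "transpose (S W) = S W"
  by (simp add: S_def transpose_add transpose_gram)

text \<open>The shift by \<tau> keeps \<open>S W\<close> positive definite whatever the rank of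
  \<open>W\<close>; for this reason the loss is differentiable everywhere.\<close>

lemma S_form: "\<tau> * (v \<bullet> v) \<le> v \<bullet> (S W *v v)"
  unfolding S_def matrix_vector_mult_add_rdistrib inner_add_right gram_form
  by (simp add: matrix_vector_mul_mat)

lemma congr_form: "v \<bullet> ((A ** S W ** A) *v v) = (A *v v) \<bullet> (S W *v (A *v v))"
  by (simp add: symmetric_inner[OF A_sym] flip: matrix_vector_mul_assoc)

lemma psd_congr: "psd (A ** S W ** A)"
proof -
  have "0 \<le> w \<bullet> (S W *v w)" for w
    using S_form[of w W] tau_pos by (meson inner_ge_zero mult_nonneg_nonneg less_imp_le order_trans)
  then show ?thesis
    unfolding psd_def congr_form by (simp add: matrix_transpose_mul A_sym S_sym matrix_mul_assoc)
qed

lemma X_psd: "psd (X W)" and XX: "X W ** X W = A ** S W ** A"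
  using psd_msqrt[OF psd_congr] by (auto simp: X_def)

lemma X_sym: "transpose (X W) = X W"
  using X_psd[of W] by (simp add: psd_def)

lemma X_inverse: "matrix_inv (X W) ** X W = mat 1" "X W ** matrix_inv (X W) = mat 1"
proof -
  have "v = 0" if "X W *v v = 0" for v
  proof -
    have "(A ** S W ** A) *v v = 0"
      using that by (simp add: XX[symmetric] flip: matrix_vector_mul_assoc)
    then have "\<tau> * ((A *v v) \<bullet> (A *v v)) \<le> 0"
      using S_form[of "A *v v" W] congr_form[of v W] by simp
    then have "(A *v v) \<bullet> (A *v v) \<le> 0" using tau_pos by (simp add: mult_le_0_iff)
    then have "A *v v = 0" by (metis inner_gt_zero_iff not_le)
    then have "(A ** A) *v v = 0" by (simp flip: matrix_vector_mul_assoc)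
    then have "\<Sigma>\<^sub>0 *v v = 0" by (simp only: AA)
    then show ?thesis by (rule inj_Sigma)
  qed
  then have "\<exists>Z. Z ** X W = mat 1" by (simp add: matrix_left_invertible_ker)
  then have "invertible (X W)" by (simp add: invertible_left_inverse)
  then show "matrix_inv (X W) ** X W = mat 1" "X W ** matrix_inv (X W) = mat 1"
    by (auto simp: invertible_def matrix_inv_def intro: someI2_ex)
qed

lemma matrix_inv_X_sym: "transpose (matrix_inv (X W)) = matrix_inv (X W)"
proof -
  have "transpose (matrix_inv (X W)) ** X W = mat 1"
    by (metis X_inverse(2) X_sym matrix_transpose_mul transpose_mat)
  then show ?thesis by (metis X_inverse(2) matrix_mul_assoc matrix_mul_lid matrix_mul_rid)
qed

lemma P_sym: "transpose (P W) = P W"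
  by (simp add: P_def matrix_transpose_mul A_sym matrix_inv_X_sym matrix_mul_assoc)

lemma P_S_P: "P W ** S W ** P W = \<Sigma>\<^sub>0"
proof -
  have "P W ** S W ** P W = A ** matrix_inv (X W) ** (A ** S W ** A) ** matrix_inv (X W) ** A"
    by (simp add: P_def matrix_mul_assoc)
  also have "\<dots> = A ** (matrix_inv (X W) ** X W) ** (X W ** matrix_inv (X W)) ** A"
    unfolding XX[symmetric] by (simp only: matrix_mul_assoc)
  finally show ?thesis by (simp add: X_inverse AA)
qed

text \<open>Determines \<open>X\<close> and \<open>P\<close> from a guess: (ARA)^2 = A R (QSQ) R A =
  ASA, so ARA is the root by uniqueness. Roots are evaluated this way in spectral coordinates,
  without an explicit form of \<open>A\<close>.\<close>

lemma X_P_eqI: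
  assumes R: "psd R" and RQ: "R ** Q = mat 1" and QSQ: "Q ** S W ** Q = \<Sigma>\<^sub>0"
  shows "X W = A ** R ** A" "P W = Q"
proof -
  have QR: "Q ** R = mat 1" using RQ by (simp add: matrix_left_right_inverse)
  have "psd (A ** R ** A)"
    using R by (auto simp: psd_def matrix_transpose_mul A_sym matrix_mul_assoc
        symmetric_inner[OF A_sym, symmetric] simp flip: matrix_vector_mul_assoc)
  moreover have "(A ** R ** A) ** (A ** R ** A) = A ** S W ** A"
  proof -
    have "(A ** R ** A) ** (A ** R ** A) = A ** R ** (A ** A) ** R ** A"
      by (simp only: matrix_mul_assoc)
    also have "\<dots> = A ** (R ** Q) ** S W ** (Q ** R) ** A"
    proof -
      have "A ** A = Q ** S W ** Q" by (simp add: AA QSQ)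
      then show ?thesis by (simp only: matrix_mul_assoc[symmetric])
    qed
    finally show ?thesis by (simp add: RQ QR)
  qed
  ultimately show X: "X W = A ** R ** A"
    unfolding X_def by (rule msqrt_unique)
  have "A ** (R ** A ** matrix_inv (X W)) = mat 1"
    using X_inverse(2)[of W] by (simp add: X matrix_mul_assoc)
  then have "R ** A ** matrix_inv (X W) ** A = mat 1"
    by (simp add: matrix_left_right_inverse)
  then have "R ** P W = mat 1" by (simp add: P_def matrix_mul_assoc)
  then show "P W = Q" by (metis QR matrix_mul_assoc matrix_mul_lid matrix_mul_rid)
qed

lemma L1_eq: "L1 \<tau> \<Sigma>\<^sub>0 W = trace (S W) + trace \<Sigma>\<^sub>0 - 2 * trace (X W)"
  by (simp add: L1_def S_def X_def A_def trace_add trace_sub trace_scaleR)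

lemma S_has_derivative: "(S has_derivative (\<lambda>H. W ** transpose H + H ** transpose W)) (at W)"
  for W :: "real^'m^'n"
proof -
  have "((\<lambda>W::real^'m^'n. W ** transpose W + mat \<tau>) has_derivative
      (\<lambda>H. (W ** transpose H + H ** transpose W) + 0)) (at W)"
    by (intro has_derivative_add has_derivative_const
        bounded_bilinear.FDERIV[OF bounded_bilinear_matrix_mult]
        bounded_linear.has_derivative[OF bounded_linear_transpose] has_derivative_ident)
  then show ?thesis by (simp add: S_def[abs_def])
qed

text \<open>The root moves by at most K3 / c times the change of \<open>S\<close>, where K3 bounds
  congruence by \<open>A\<close> and c bounds \<open>X W\<close> from below. The remainder is
  quadratic in that movement, with K1 and K2 bounding the trace functional and the product.\<close>

lemma L1_remainder_bound:
  fixes W :: "real^'m^'n"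
  obtains K where "\<And>W'. \<bar>trace (matrix_inv (X W) ** ((X W' - X W) ** (X W' - X W)))\<bar>
     \<le> K * ((S W' - S W) \<bullet> (S W' - S W))"
proof -
  let ?Z = "matrix_inv (X W)"
  obtain c where c: "0 < c" "\<And>v. c * (v \<bullet> v) \<le> v \<bullet> (X W *v v)"
    by (rule psd_invertible_lower_bound[OF X_psd X_inverse(1)]) blast
  have "bounded_linear (\<lambda>M. trace (?Z ** M))"
    by (intro bounded_linear_compose[OF bounded_linear_trace]
        bounded_bilinear.bounded_linear_right[OF bounded_bilinear_matrix_mult])
  then obtain K1 where K1: "0 \<le> K1" "\<And>M. norm (trace (?Z ** M)) \<le> norm M * K1"
    by (metis bounded_linear.nonneg_bounded)
  obtain K2 where K2: "0 \<le> K2" "\<And>(M :: real^'n^'n) (N :: real^'n^'n). norm (M ** N) \<le> norm M * norm N * K2"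
    using bounded_bilinear.nonneg_bounded[OF bounded_bilinear_matrix_mult] by metis
  have "bounded_linear (\<lambda>M. A ** M ** A)"
    by (intro bounded_linear_compose[OF bounded_bilinear.bounded_linear_left[OF bounded_bilinear_matrix_mult]]
        bounded_bilinear.bounded_linear_right[OF bounded_bilinear_matrix_mult])
  then obtain K3 where K3: "0 \<le> K3" "\<And>M. norm (A ** M ** A) \<le> norm M * K3"
    by (metis bounded_linear.nonneg_bounded)
  have "\<bar>trace (?Z ** ((X W' - X W) ** (X W' - X W)))\<bar>
     \<le> (K1 * K2 * (K3 / c)^2) * ((S W' - S W) \<bullet> (S W' - S W))" for W'
  proof -
    let ?E = "X W' - X W" and ?D = "S W' - S W"
    have "c * norm ?E \<le> norm (X W' ** X W' - X W ** X W)"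
      using psd_sqrt_lipschitz[OF X_psd X_psd c(2)] by (simp add: norm_minus_commute)
    also have "\<dots> = norm (A ** ?D ** A)" by (simp add: XX mat_algebra)
    also have "\<dots> \<le> norm ?D * K3" by (rule K3)
    finally have E: "norm ?E \<le> norm ?D * (K3 / c)" using c(1) by (simp add: field_simps)
    have "norm (trace (?Z ** (?E ** ?E))) \<le> norm (?E ** ?E) * K1" by (rule K1)
    also have "\<dots> \<le> (norm ?E * norm ?E * K2) * K1" by (intro mult_right_mono K2 K1)
    also have "\<dots> \<le> ((norm ?D * (K3 / c)) * (norm ?D * (K3 / c)) * K2) * K1"
      using c(1) K3(1) by (intro mult_right_mono mult_mono E K1 K2) auto
    finally show ?thesis by (simp add: dot_square_norm power2_eq_square mult_ac)
  qed
  then show ?thesis by (rule that)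
qed

text \<open>The exact trace expansion writes the loss as a linear functional \<open>T\<close> of
  \<open>S W'\<close>, plus a constant, plus a quadratic remainder. Only \<open>T\<close> and the
  polynomial \<open>S\<close> are differentiated, and T M = trace ((I - P) M) yields the
  gradient.\<close>

lemma L1_has_derivative:
  "(L1 \<tau> \<Sigma>\<^sub>0 has_derivative (\<lambda>H. 2 * ((W - P W ** W) \<bullet> H))) (at W)"
  for W :: "real^'m^'n"
proof -
  let ?Z = "matrix_inv (X W)"
  define T where "T M = trace M - trace (?Z ** (A ** M ** A))" for M
  define R where "R W' = trace (?Z ** ((X W' - X W) ** (X W' - X W)))" for W' :: "real^'m^'n"
  have bT: "bounded_linear T"
    unfolding T_def
    by (intro bounded_linear_sub bounded_linear_trace bounded_linear_compose[OF bounded_linear_trace]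
        bounded_linear_compose[OF bounded_bilinear.bounded_linear_left[OF bounded_bilinear_matrix_mult]]
        bounded_linear_compose[OF bounded_bilinear.bounded_linear_right[OF bounded_bilinear_matrix_mult]]
        bounded_bilinear.bounded_linear_right[OF bounded_bilinear_matrix_mult])
  have "L1 \<tau> \<Sigma>\<^sub>0 W' = T (S W') + (trace \<Sigma>\<^sub>0 - 2 * trace (X W) + trace (?Z ** (A ** S W ** A))) + R W'"
    for W' :: "real^'m^'n"
  proof -
    have "trace (?Z ** (X W' ** X W' - X W ** X W))
        = trace (?Z ** (A ** S W' ** A)) - trace (?Z ** (A ** S W ** A))"
      by (simp only: XX matrix_mult_diff_right trace_sub)
    with trace_sqrt_expansion[OF X_inverse(1)[of W], of "X W'"] show ?thesis
      unfolding L1_eq R_def T_def by linarith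
  qed
  then have eq: "L1 \<tau> \<Sigma>\<^sub>0 = (\<lambda>W'::real^'m^'n. T (S W') + (trace \<Sigma>\<^sub>0 - 2 * trace (X W) + trace (?Z ** (A ** S W ** A))) + R W')"
    by (rule ext)
  have R0: "(R has_derivative (\<lambda>_. 0)) (at W)"
  proof -
    obtain K where K: "\<And>W'. \<bar>R W'\<bar> \<le> K * ((S W' - S W) \<bullet> (S W' - S W))"
      unfolding R_def using L1_remainder_bound by blast
    \<comment> \<open>Both factors vanish at \<open>W\<close>, so the product rule leaves
      zero.\<close>
    have "((\<lambda>W'. K * ((S W' - S W) \<bullet> (S W' - S W))) has_derivative (\<lambda>H. 0)) (at W)"
      by (rule derivative_eq_intros S_has_derivative refl | simp)+
    from has_derivative_zero_squeeze[OF this _ K] show ?thesis by simp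
  qed
  have "(L1 \<tau> \<Sigma>\<^sub>0 has_derivative (\<lambda>H. T (W ** transpose H + H ** transpose W) + 0 + 0)) (at W)"
    unfolding eq
    by (intro has_derivative_add has_derivative_const R0 bounded_linear.has_derivative[OF bT] S_has_derivative)
  moreover have "T (W ** transpose H + H ** transpose W) + 0 + 0 = 2 * ((W - P W ** W) \<bullet> H)" for H
  proof -
    have 1: "trace (?Z ** (A ** M ** A)) = trace (P W ** M)" for M
      by (metis P_def matrix_mul_assoc trace_mul_sym)
    have 2: "trace (W ** transpose H) = W \<bullet> H" "trace (H ** transpose W) = W \<bullet> H"
      by (metis inner_matrix trace_mul_sym inner_commute)+
    have 3: "trace (P W ** (W ** transpose H)) = (P W ** W) \<bullet> H"
      by (metis inner_matrix trace_mul_sym inner_commute matrix_mul_assoc)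
    have 4: "trace (P W ** (H ** transpose W)) = (P W ** W) \<bullet> H"
      by (metis inner_matrix trace_mul_sym matrix_mul_assoc matrix_transpose_mul P_sym)
    show ?thesis
      unfolding T_def 1 by (simp add: matrix_add_ldistrib trace_add 2 3 4 inner_diff_left)
  qed
  ultimately show ?thesis by simp
qed

end

subsection \<open>Critical points on the fixed-rank manifold\<close>

lemma gram_zero: "M ** transpose M = 0 \<Longrightarrow> M = 0" for M :: "real^'m^'n"
proof -
  assume "M ** transpose M = 0"
  then have "trace (transpose M ** M) = 0" by (subst trace_mul_sym) (simp add: trace_def)
  then show "M = 0" by (simp add: inner_matrix[symmetric])
qed

text \<open>The Gram matrix of QW is (Q W W^T) Q^T, which vanishes.\<close>

lemma mult_gram_zeroD: "Q ** (W ** transpose W) = 0 \<Longrightarrow> Q ** W = 0"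
  for W :: "real^'m^'n" and Q :: "real^'n^'k"
proof -
  assume "Q ** (W ** transpose W) = 0"
  then have "(Q ** W) ** transpose (Q ** W) = 0"
    by (metis matrix_transpose_mul matrix_mul_assoc bounded_bilinear.zero_left[OF bounded_bilinear_matrix_mult])
  then show ?thesis by (rule gram_zero)
qed

text \<open>Row space and kernel are orthogonal. The row space is the subspace on which
  \<open>W\<close> is injective, both for the rank of the Gram matrix and for semicontinuity of the
  rank.\<close>

lemma row_space_kernel_trivial:
  fixes W :: "real^'m^'n"
  assumes "x \<in> range ((*v) (transpose W))" "W *v x = 0"
  shows "x = 0"
proof -
  obtain v where v: "x = transpose W *v v" using assms(1) by blast
  then have "v \<bullet> ((W ** transpose W) *v v) = 0" using assms(2) by (simp flip: matrix_vector_mul_assoc)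
  then have "x \<bullet> x = 0" by (simp only: gram_form v)
  then show ?thesis by simp
qed

lemma dim_image_trivial_kernel:
  fixes M :: "real^'m^'n"
  assumes U: "subspace U" and ker: "\<And>x. x \<in> U \<Longrightarrow> M *v x = 0 \<Longrightarrow> x = 0"
  shows "dim ((*v) M ` U) = dim U"
proof -
  have "inj_on ((*v) M) U"
  proof (rule inj_onI)
    fix x y assume "x \<in> U" "y \<in> U" "M *v x = M *v y"
    then have "x - y = 0"
      using U by (intro ker) (auto simp: subspace_diff matrix_vector_mult_diff_distrib)
    then show "x = y" by simp
  qed
  then show ?thesis
    using U by (intro dim_image_eq matrix_vector_mul_linear) (simp add: span_eq_iff[THEN iffD2])
qed

text \<open>\<open>W\<close> maps its row space, of dimension \<open>rank W\<close>, injectively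
  onto the range of W W^T.\<close>

lemma rank_gram: "rank (W ** transpose W) = rank W" for W :: "real^'m^'n"
proof -
  let ?R = "range ((*v) (transpose W))"
  have "subspace ?R" by (intro linear_subspace_image matrix_vector_mul_linear) simp
  then have "dim ((*v) W ` ?R) = dim ?R"
    using row_space_kernel_trivial by (rule dim_image_trivial_kernel)
  moreover have "(*v) W ` ?R = range ((*v) (W ** transpose W))"
    by (simp add: image_image matrix_vector_mul_assoc del: transpose_matrix_vector)
  ultimately show ?thesis by (metis rank_dim_range rank_transpose)
qed

lemma rank_mult_left_inverse:
  fixes W :: "real^'m^'n"
  assumes "Z ** Q = mat 1"
  shows "rank (Q ** W) = rank W"
proof (rule antisym)
  show "rank (Q ** W) \<le> rank W" by (rule rank_mul_le_right)
  have "rank W = rank (Z ** (Q ** W))" by (simp add: matrix_mul_assoc assms)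
  also have "\<dots> \<le> rank (Q ** W)" by (rule rank_mul_le_right)
  finally show "rank W \<le> rank (Q ** W)" .
qed

text \<open>The curve is (I + tK) W. As long as |t| times a bound \<open>B\<close> for the operator
  norm of \<open>K\<close> is below 1, the left factor is injective, hence invertible, and leaves
  the rank alone.\<close>

lemma curve_in_fixed_rank:
  fixes W :: "real^'m^'n"
  assumes "rank W = r"
  shows "curve_in (fixed_rank r) W (K ** W) (\<lambda>t. W + t *\<^sub>R (K ** W))"
proof -
  let ?\<gamma> = "\<lambda>t::real. W + t *\<^sub>R (K ** W)"
  obtain B where B: "0 < B" "\<And>v. norm (K *v v) \<le> norm v * B"
    using bounded_linear.pos_bounded[OF matrix_vector_mul_bounded_linear[of K]] by blast
  have deriv: "(?\<gamma> has_vector_derivative (K ** W)) (at t)" for t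
    by (auto intro!: derivative_eq_intros)
  have "?\<gamma> t \<in> fixed_rank r" if t: "t \<in> {- (1/B)<..<1/B}" for t
  proof -
    have tB: "\<bar>t\<bar> * B < 1" using t B(1) by (auto simp: abs_if field_simps)
    have "v = 0" if "(mat 1 + t *\<^sub>R K) *v v = 0" for v
    proof (rule ccontr)
      assume "v \<noteq> 0"
      have "v = - (t *\<^sub>R (K *v v))"
        using that by (simp add: matrix_vector_mult_add_rdistrib scaleR_matrix_vector_assoc eq_neg_iff_add_eq_0)
      then have "norm v = \<bar>t\<bar> * norm (K *v v)" by (metis norm_minus_cancel norm_scaleR)
      also have "\<dots> \<le> \<bar>t\<bar> * (norm v * B)" by (intro mult_left_mono B) simp
      also have "\<dots> = (\<bar>t\<bar> * B) * norm v" by simp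
      also have "\<dots> < 1 * norm v" using \<open>v \<noteq> 0\<close> by (intro mult_strict_right_mono tB) simp
      finally show False by simp
    qed
    then have "\<exists>Z. Z ** (mat 1 + t *\<^sub>R K) = mat 1" by (simp add: matrix_left_invertible_ker)
    then obtain Z where "Z ** (mat 1 + t *\<^sub>R K) = mat 1" ..
    from rank_mult_left_inverse[OF this, of W] assms show ?thesis
      by (simp add: fixed_rank_def matrix_add_rdistrib matrix_mult_scaleR_left)
  qed
  then have "?\<gamma> ` {- (1/B)<..<1/B} \<subseteq> fixed_rank r" by blast
  moreover have "?\<gamma> C1_differentiable_on {- (1/B)<..<1/B}"
    unfolding C1_differentiable_on_def using deriv by (intro exI[of _ "\<lambda>_. K ** W"]) auto
  ultimately show ?thesis
    unfolding curve_in_def using deriv[of 0] B(1) by (intro conjI exI[of _ "1/B"]) auto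
qed

context perturbed_bures
begin

lemma L1_curve_derivative:
  assumes "\<gamma> 0 = W" "(\<gamma> has_vector_derivative H) (at 0)"
  shows "((L1 \<tau> \<Sigma>\<^sub>0 \<circ> \<gamma>) has_real_derivative 2 * ((W - P W ** W) \<bullet> H)) (at 0)"
proof -
  have "(L1 \<tau> \<Sigma>\<^sub>0 has_derivative (\<lambda>H. 2 * ((W - P W ** W) \<bullet> H))) (at (\<gamma> 0))"
    using L1_has_derivative[of W] assms(1) by simp
  from diff_chain_at[OF assms(2)[unfolded has_vector_derivative_def] this] show ?thesis
    by (rule has_derivative_imp_has_field_derivative) simp
qed

text \<open>The hypothesis asks only for derivatives along the lines (I + tK) W, so that it serves
  critical points of fixed rank as well as minimisers of bounded rank.\<close>

lemma critical_imp_P_fixes: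
  fixes W :: "real^'m^'n"
  assumes "\<And>K :: real^'n^'n. ((\<lambda>t. L1 \<tau> \<Sigma>\<^sub>0 (W + t *\<^sub>R (K ** W))) has_real_derivative 0) (at 0)"
  shows "P W ** W = W"
proof -
  \<comment> \<open>Chosen so that the derivative along KW is 2 |K|^2: with G = W - PW and K = G
    W^T, the inner product of G and KW is trace (K W G^T) = trace (K K^T).\<close>
  let ?K = "(W - P W ** W) ** transpose W"
  have "((\<lambda>t. W + t *\<^sub>R (?K ** W)) has_vector_derivative (?K ** W)) (at 0)"
    by (auto intro!: derivative_eq_intros)
  from L1_curve_derivative[OF _ this]
  have "((\<lambda>t. L1 \<tau> \<Sigma>\<^sub>0 (W + t *\<^sub>R (?K ** W))) has_real_derivative
       2 * ((W - P W ** W) \<bullet> (?K ** W))) (at 0)" by (simp add: o_def)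
  from DERIV_unique[OF this assms] have "(W - P W ** W) \<bullet> (?K ** W) = 0" by simp
  also have "(W - P W ** W) \<bullet> (?K ** W) = ?K \<bullet> ?K"
  proof -
    have "(W - P W ** W) \<bullet> (?K ** W) = trace ((?K ** W) ** transpose (W - P W ** W))"
      unfolding inner_matrix by (rule trace_mul_sym)
    also have "\<dots> = trace (?K ** transpose ?K)"
      by (simp only: matrix_transpose_mul matrix_mul_assoc transpose_transpose)
    also have "\<dots> = ?K \<bullet> ?K" unfolding inner_matrix by (rule trace_mul_sym)
    finally show ?thesis .
  qed
  finally have "?K = 0" by simp
  moreover have "?K = (mat 1 - P W) ** (W ** transpose W)" by (simp add: mat_algebra)
  ultimately have "(mat 1 - P W) ** W = 0" by (metis mult_gram_zeroD)
  then show ?thesis by (simp add: matrix_mult_diff_left)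
qed

text \<open>Backwards, \<open>P W ** W = W\<close> makes the whole Euclidean gradient vanish, so
  every curve through \<open>W\<close> has derivative zero and the tangent space never has to be
  described.\<close>

lemma critical_point_iff:
  fixes W :: "real^'m^'n"
  shows "critical_point_on (L1 \<tau> \<Sigma>\<^sub>0) (fixed_rank r) W \<longleftrightarrow> rank W = r \<and> P W ** W = W"
proof safe
  assume c: "critical_point_on (L1 \<tau> \<Sigma>\<^sub>0) (fixed_rank r) W"
  then show r: "rank W = r" by (simp add: critical_point_on_def fixed_rank_def)
  show "P W ** W = W"
  proof (rule critical_imp_P_fixes)
    fix K :: "real^'n^'n"
    from c curve_in_fixed_rank[OF r, of K]
    show "((\<lambda>t. L1 \<tau> \<Sigma>\<^sub>0 (W + t *\<^sub>R (K ** W))) has_real_derivative 0) (at 0)"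
      unfolding critical_point_on_def has_differential_on_def o_def by blast
  qed
next
  assume "P W ** W = W"
  then show "critical_point_on (L1 \<tau> \<Sigma>\<^sub>0) (fixed_rank (rank W)) W"
    using L1_curve_derivative[where W = W]
    by (fastforce simp: critical_point_on_def fixed_rank_def has_differential_on_def curve_in_def)
qed

lemma P_fixes_iff_gram: "P W ** W = W \<longleftrightarrow> P W ** (W ** transpose W) = W ** transpose W"
proof
  assume "P W ** (W ** transpose W) = W ** transpose W"
  then have "(mat 1 - P W) ** (W ** transpose W) = 0" by (simp add: matrix_mult_diff_left)
  from mult_gram_zeroD[OF this] show "P W ** W = W" by (simp add: matrix_mult_diff_left)
qed (simp add: matrix_mul_assoc)

text \<open>Since PM = M = MP, expanding P (M + \<tau> I) P gives \<open>\<Sigma>\<^sub>0\<close> =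
  M + \<tau> P^2. Multiplying by M from either side produces the same matrix M^2 + \<tau> M.\<close>

lemma P_fixes_imp_gram_eq:
  fixes W :: "real^'m^'n"
  assumes "P W ** W = W"
  defines "M \<equiv> W ** transpose W"
  shows "\<Sigma>\<^sub>0 ** M = M ** M + \<tau> *\<^sub>R M" "\<Sigma>\<^sub>0 ** M = M ** \<Sigma>\<^sub>0"
proof -
  have Ms: "transpose M = M" by (simp add: M_def transpose_gram)
  have PM: "P W ** M = M" using assms by (simp add: matrix_mul_assoc)
  have MP: "M ** P W = M" by (metis PM Ms P_sym matrix_transpose_mul)
  have "S W = M + \<tau> *\<^sub>R mat 1" by (simp add: S_def M_def mat_eq_scaleR[of \<tau>])
  then have "\<Sigma>\<^sub>0 = P W ** M ** P W + \<tau> *\<^sub>R (P W ** P W)"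
    using P_S_P[of W] by (simp add: matrix_add_ldistrib matrix_add_rdistrib matrix_mult_scaleR_left matrix_mult_scaleR_right)
  then have Sig: "\<Sigma>\<^sub>0 = M + \<tau> *\<^sub>R (P W ** P W)" by (simp only: PM MP)
  have 1: "(M + \<tau> *\<^sub>R (P W ** P W)) ** M = M ** M + \<tau> *\<^sub>R M"
    by (simp add: matrix_add_rdistrib matrix_mult_scaleR_left) (metis PM matrix_mul_assoc)
  have 2: "M ** (M + \<tau> *\<^sub>R (P W ** P W)) = M ** M + \<tau> *\<^sub>R M"
    by (simp add: matrix_add_ldistrib matrix_mult_scaleR_right) (metis MP matrix_mul_assoc)
  show "\<Sigma>\<^sub>0 ** M = M ** M + \<tau> *\<^sub>R M" using 1 Sig by metis
  then show "\<Sigma>\<^sub>0 ** M = M ** \<Sigma>\<^sub>0" using 2 Sig by metis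
qed

end

subsection \<open>Spectral coordinates\<close>

lemma diag_mult_nth: "(diag d ** B) $ i $ j = d $ i * B $ i $ j"
  by (simp add: diag_def matrix_matrix_mult_def if_distrib[of "\<lambda>x. x * _"] cong: if_cong)

lemma mult_diag_nth: "(B ** diag d) $ i $ j = B $ i $ j * d $ j"
  by (simp add: diag_def matrix_matrix_mult_def if_distrib[of "\<lambda>x. _ * x"] cong: if_cong)

lemma diag_nth: "diag d $ i $ j = (if i = j then d $ i else 0)"
  by (simp add: diag_def)

lemma diag_mult: "diag a ** diag b = diag (a * b)"
  by (simp add: vec_eq_iff diag_mult_nth diag_nth)

lemma diag_vec_mult: "diag a *v v = a * v"
  by (simp add: vec_eq_iff diag_def matrix_vector_mult_def if_distrib[of "\<lambda>x. x * _"] cong: if_cong)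

lemma transpose_diag: "transpose (diag a) = diag a"
  by (auto simp: vec_eq_iff transpose_def diag_nth)

lemma trace_diag: "trace (diag a) = (\<Sum>i\<in>UNIV. a $ i)"
  by (simp add: trace_def diag_nth)

lemma rank_diag: "rank (diag a) = card {i. a $ i \<noteq> 0}" for a :: "real^'n"
proof -
  have "range ((*v) (diag a)) = {x. \<forall>i. i \<notin> {i. a $ i \<noteq> 0} \<longrightarrow> x $ i = 0}"
  proof (intro set_eqI iffI)
    fix x :: "real^'n" assume "x \<in> {x. \<forall>i. i \<notin> {i. a $ i \<noteq> 0} \<longrightarrow> x $ i = 0}"
    then have "x = diag a *v (\<chi> i. x $ i / a $ i)" by (auto simp: diag_vec_mult vec_eq_iff)
    then show "x \<in> range ((*v) (diag a))" by (rule range_eqI)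
  qed (auto simp: diag_vec_mult)
  then show ?thesis
    unfolding rank_dim_range by (simp only: dim_substandard_cart dim_vec_eq[symmetric])
qed

lemma psd_diag: "(\<And>i. 0 \<le> a $ i) \<Longrightarrow> psd (diag a)"
  by (auto simp: psd_def transpose_diag diag_vec_mult inner_vec_def intro!: sum_nonneg)
    (metis mult.left_commute mult_nonneg_nonneg zero_le_square)

lemma msqrt_diag: "(\<And>i. 0 \<le> a $ i) \<Longrightarrow> msqrt (diag a) = diag (\<chi> i. sqrt (a $ i))"
  by (intro msqrt_unique psd_diag) (auto simp: diag_mult vec_eq_iff diag_nth)

section \<open>Scalar calculus in the eigenbasis\<close>

locale spectral_bures =
  fixes \<tau> :: real and \<Omega> :: "real^'n^'n" and lam :: "real^'n"
  assumes tau: "0 < \<tau>" and orth: "orthogonal_matrix \<Omega>"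
    and lam_pos: "\<And>i. 0 < lam $ i" and lam_inj: "\<And>i j. lam $ i = lam $ j \<Longrightarrow> i = j"
begin

text \<open>Functional calculus for \<open>spectral_mat lam\<close>, which plays the role of
  \<open>\<Sigma>\<^sub>0\<close>: sums and componentwise products of vectors become sums and
  products of matrices, so identities are checked eigenvalue by eigenvalue.\<close>

definition spectral_mat :: "real^'n \<Rightarrow> real^'n^'n" where
  "spectral_mat a = \<Omega> ** diag a ** transpose \<Omega>"

lemma OO: "transpose \<Omega> ** \<Omega> = mat 1" "\<Omega> ** transpose \<Omega> = mat 1"
  using orth by (auto simp: orthogonal_matrix_def)

lemma spectral_mat_mult: "spectral_mat a ** spectral_mat b = spectral_mat (a * b)"
proof -
  have "spectral_mat a ** spectral_mat b = \<Omega> ** diag a ** (transpose \<Omega> ** \<Omega>) ** diag b ** transpose \<Omega>"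
    by (simp only: spectral_mat_def matrix_mul_assoc)
  then show ?thesis by (simp add: OO spectral_mat_def diag_mult flip: matrix_mul_assoc[of \<Omega>])
qed

lemma spectral_mat_add: "spectral_mat a + spectral_mat b = spectral_mat (a + b)"
proof -
  have "diag (a + b) = diag a + diag b" by (simp add: vec_eq_iff diag_nth)
  then show ?thesis by (simp add: spectral_mat_def matrix_add_ldistrib matrix_add_rdistrib)
qed

lemma spectral_mat_const: "spectral_mat (\<chi> i. c) = mat c"
proof -
  have "diag (\<chi> i. c) = c *\<^sub>R (mat 1 :: real^'n^'n)" by (simp add: vec_eq_iff diag_nth mat_def)
  then show ?thesis
    by (simp add: spectral_mat_def matrix_mult_scaleR_left matrix_mult_scaleR_right OO)
      (simp add: vec_eq_iff mat_def)
qed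

lemma diag_conj: "transpose \<Omega> ** spectral_mat a ** \<Omega> = diag a"
proof -
  have "transpose \<Omega> ** spectral_mat a ** \<Omega> = (transpose \<Omega> ** \<Omega>) ** diag a ** (transpose \<Omega> ** \<Omega>)"
    by (simp only: spectral_mat_def matrix_mul_assoc)
  then show ?thesis by (simp add: OO)
qed

lemma spectral_mat_diag: "transpose \<Omega> ** M ** \<Omega> = diag a \<Longrightarrow> M = spectral_mat a"
proof -
  assume "transpose \<Omega> ** M ** \<Omega> = diag a"
  then have "spectral_mat a = \<Omega> ** (transpose \<Omega> ** M ** \<Omega>) ** transpose \<Omega>"
    by (simp only: spectral_mat_def)
  also have "\<dots> = (\<Omega> ** transpose \<Omega>) ** M ** (\<Omega> ** transpose \<Omega>)"
    by (simp only: matrix_mul_assoc)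
  finally show ?thesis by (simp add: OO)
qed

lemma spectral_mat_inject: "spectral_mat a = spectral_mat b \<longleftrightarrow> a = b"
proof
  assume "spectral_mat a = spectral_mat b"
  then have "diag a = diag b" by (metis diag_conj)
  then show "a = b" by (metis diag_nth vec_eq_iff)
qed simp

lemma spectral_mat_transpose: "transpose (spectral_mat a) = spectral_mat a"
  by (simp add: spectral_mat_def matrix_transpose_mul transpose_diag matrix_mul_assoc)

lemma spectral_mat_trace: "trace (spectral_mat a) = (\<Sum>i\<in>UNIV. a $ i)"
  by (metis OO(1) spectral_mat_def matrix_mul_assoc matrix_mul_lid trace_diag trace_mul_sym)

lemma spectral_mat_psd:
  assumes "\<And>i. 0 \<le> a $ i"
  shows "psd (spectral_mat a)"
proof -
  have "v \<bullet> (spectral_mat a *v v) = (transpose \<Omega> *v v) \<bullet> (diag a *v (transpose \<Omega> *v v))" for v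
    by (simp add: spectral_mat_def dot_lmul_matrix flip: matrix_vector_mul_assoc)
  with psd_diag[of a] assms show ?thesis by (simp add: psd_def spectral_mat_transpose)
qed

lemma spectral_mat_rank: "rank (spectral_mat a) = card {i. a $ i \<noteq> 0}"
proof (rule antisym)
  have "rank (spectral_mat a) \<le> rank (\<Omega> ** diag a)" unfolding spectral_mat_def by (rule rank_mul_le_left)
  also have "\<dots> \<le> rank (diag a)" by (rule rank_mul_le_right)
  finally show "rank (spectral_mat a) \<le> card {i. a $ i \<noteq> 0}" by (simp add: rank_diag)
  have "rank (diag a) \<le> rank (transpose \<Omega> ** spectral_mat a)" unfolding diag_conj[symmetric] by (rule rank_mul_le_left)
  also have "\<dots> \<le> rank (spectral_mat a)" by (rule rank_mul_le_right)
  finally show "card {i. a $ i \<noteq> 0} \<le> rank (spectral_mat a)" by (simp add: rank_diag)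
qed

sublocale perturbed_bures \<tau> "spectral_mat lam"
proof
  show "0 < \<tau>" by (rule tau)
  show "psd (spectral_mat lam)" using lam_pos by (intro spectral_mat_psd) (simp add: less_imp_le)
  show "v = 0" if "spectral_mat lam *v v = 0" for v
  proof -
    have "spectral_mat (\<chi> i. 1 / lam $ i) ** spectral_mat lam = spectral_mat (\<chi> i. 1)"
      unfolding spectral_mat_mult spectral_mat_inject using lam_pos by (simp add: vec_eq_iff less_imp_neq[symmetric])
    then have "spectral_mat (\<chi> i. 1 / lam $ i) ** spectral_mat lam = mat 1" by (simp add: spectral_mat_const)
    then show ?thesis using that by (metis matrix_left_invertible_ker)
  qed
qed

text \<open>The Gram matrix shares the eigenbasis of \<open>\<Sigma>\<^sub>0\<close>, so Q S Q =
  \<open>\<Sigma>\<^sub>0\<close> is solved by the scalars q_i = sqrt (lam_i / (d_i + \<tau>)), with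
  R the inverse of Q. By cyclicity the trace of ARA is that of R \<open>\<Sigma>\<^sub>0\<close>,
  which removes \<open>A\<close>.\<close>

lemma spectral_value_aux:
  fixes W :: "real^'m^'n"
  assumes gram: "W ** transpose W = spectral_mat d" and d0: "\<And>i. 0 \<le> d $ i"
  shows "trace (X W) = (\<Sum>i\<in>UNIV. sqrt (lam $ i) * sqrt (d $ i + \<tau>))"
    and "P W = spectral_mat (\<chi> i. sqrt (lam $ i / (d $ i + \<tau>)))"
proof -
  let ?R = "spectral_mat (\<chi> i. sqrt ((d $ i + \<tau>) / lam $ i))"
  let ?Q = "spectral_mat (\<chi> i. sqrt (lam $ i / (d $ i + \<tau>)))"
  have s0: "0 < d $ i + \<tau>" for i using d0[of i] tau by linarith
  have nz: "lam $ i \<noteq> 0" "d $ i + \<tau> \<noteq> 0" for i using s0[of i] lam_pos[of i] by auto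
  have nn: "0 \<le> lam $ i" "0 \<le> d $ i + \<tau>" for i using s0[of i] lam_pos[of i] by auto
  have SW: "S W = spectral_mat (\<chi> i. d $ i + \<tau>)"
  proof -
    have "(\<chi> i. d $ i + \<tau>) = d + (\<chi> i. \<tau>)" by (simp add: vec_eq_iff)
    then show ?thesis by (simp only: S_def gram spectral_mat_const[symmetric] spectral_mat_add)
  qed
  have R: "psd ?R" using nn by (intro spectral_mat_psd) simp
  have "?R ** ?Q = spectral_mat (\<chi> i. 1)"
    unfolding spectral_mat_mult spectral_mat_inject using nz nn by (simp add: vec_eq_iff real_sqrt_divide)
  then have RQ: "?R ** ?Q = mat 1" by (simp add: spectral_mat_const)
  have QSQ: "?Q ** S W ** ?Q = spectral_mat lam"
    unfolding spectral_mat_mult SW spectral_mat_inject using nz nn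
    by (simp add: vec_eq_iff real_sqrt_divide)
  from X_P_eqI[OF R RQ QSQ] show "P W = ?Q" by simp
  have "trace (X W) = trace (?R ** (A ** A))"
  proof -
    have "trace (X W) = trace ((A ** ?R) ** A)" by (simp only: X_P_eqI(1)[OF R RQ QSQ])
    also have "\<dots> = trace (A ** (A ** ?R))" by (rule trace_mul_sym)
    also have "\<dots> = trace (?R ** (A ** A))"
      unfolding matrix_mul_assoc[of A A] by (rule trace_mul_sym)
    finally show ?thesis .
  qed
  also have "\<dots> = (\<Sum>i\<in>UNIV. sqrt ((d $ i + \<tau>) / lam $ i) * lam $ i)"
    by (simp add: AA spectral_mat_mult spectral_mat_trace)
  also have "\<dots> = (\<Sum>i\<in>UNIV. sqrt (lam $ i) * sqrt (d $ i + \<tau>))"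
  proof (rule sum.cong[OF refl])
    fix i
    have "sqrt ((d $ i + \<tau>) / lam $ i) * lam $ i = sqrt (d $ i + \<tau>) * (lam $ i / sqrt (lam $ i))"
      by (simp add: real_sqrt_divide)
    then show "sqrt ((d $ i + \<tau>) / lam $ i) * lam $ i = sqrt (lam $ i) * sqrt (d $ i + \<tau>)"
      by (simp add: real_div_sqrt nn)
  qed
  finally show "trace (X W) = (\<Sum>i\<in>UNIV. sqrt (lam $ i) * sqrt (d $ i + \<tau>))" .
qed

text \<open>In the commuting case the squared Bures distance is the squared Euclidean distance
  between the roots of the eigenvalues.\<close>

lemma L1_spectral:
  fixes W :: "real^'m^'n"
  assumes gram: "W ** transpose W = spectral_mat d" and d0: "\<And>i. 0 \<le> d $ i"
  shows "L1 \<tau> (spectral_mat lam) W = (\<Sum>i\<in>UNIV. (sqrt (lam $ i) - sqrt (d $ i + \<tau>))\<^sup>2)"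
proof -
  have "trace (S W) = (\<Sum>i\<in>UNIV. d $ i + \<tau>)"
    by (simp add: S_def gram trace_add spectral_mat_trace flip: spectral_mat_const) (simp add: sum.distrib)
  moreover have "(sqrt (lam $ i) - sqrt (d $ i + \<tau>))\<^sup>2
     = (d $ i + \<tau>) + lam $ i - 2 * (sqrt (lam $ i) * sqrt (d $ i + \<tau>))" for i
    using lam_pos[of i] d0[of i] tau by (simp add: power2_diff)
  ultimately show ?thesis
    unfolding L1_eq spectral_value_aux(1)[OF assms] spectral_mat_trace
    by (simp add: sum.distrib sum_subtractf sum_distrib_left)
qed

text \<open>The eigenvalues of $WW^\top$ at the spectral point of an index set.\<close>
definition shifted :: "'n set \<Rightarrow> real^'n" where
  "shifted J = (\<chi> j. if j \<in> J then lam $ j - \<tau> else 0)"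

lemma L1_shifted:
  fixes W :: "real^'m^'n"
  assumes gram: "W ** transpose W = spectral_mat (shifted J)" and J: "\<And>j. j \<in> J \<Longrightarrow> \<tau> \<le> lam $ j"
  shows "L1 \<tau> (spectral_mat lam) W = (\<Sum>j\<in>-J. (sqrt (lam $ j) - sqrt \<tau>)\<^sup>2)"
proof -
  have "L1 \<tau> (spectral_mat lam) W = (\<Sum>i\<in>UNIV. (sqrt (lam $ i) - sqrt (shifted J $ i + \<tau>))\<^sup>2)"
    using J by (intro L1_spectral gram) (simp add: shifted_def)
  also have "\<dots> = (\<Sum>i\<in>UNIV. if i \<in> -J then (sqrt (lam $ i) - sqrt \<tau>)\<^sup>2 else 0)"
    by (intro sum.cong) (auto simp: shifted_def)
  finally show ?thesis by (simp add: sum.If_cases Compl_eq)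
qed

text \<open>On \<open>J\<close> the eigenvalue of \<open>P W\<close> is sqrt (lam_j / lam_j) = 1;
  off \<open>J\<close> the Gram matrix has eigenvalue 0.\<close>

lemma P_fixes_shifted:
  fixes W :: "real^'m^'n"
  assumes gram: "W ** transpose W = spectral_mat (shifted J)" and J: "\<And>j. j \<in> J \<Longrightarrow> \<tau> \<le> lam $ j"
  shows "P W ** W = W"
proof -
  have "P W = spectral_mat (\<chi> i. sqrt (lam $ i / (shifted J $ i + \<tau>)))"
    using J by (intro spectral_value_aux gram) (simp add: shifted_def)
  moreover have "(\<chi> i. sqrt (lam $ i / (shifted J $ i + \<tau>))) * shifted J = shifted J"
    using lam_pos by (auto simp: vec_eq_iff shifted_def less_imp_neq[symmetric])
  ultimately have "P W ** spectral_mat (shifted J) = spectral_mat (shifted J)" by (simp only: spectral_mat_mult)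
  then show ?thesis by (simp add: P_fixes_iff_gram gram)
qed

text \<open>An index of \<open>J\<close> with lam_j = \<tau> contributes the eigenvalue 0, so the
  rank can be smaller than the number of indices.\<close>

lemma rank_shifted:
  fixes W :: "real^'m^'n"
  assumes "W ** transpose W = spectral_mat (shifted J)"
  shows "rank W = card {j\<in>J. lam $ j \<noteq> \<tau>}"
proof -
  have "{i. shifted J $ i \<noteq> 0} = {j\<in>J. lam $ j \<noteq> \<tau>}" by (auto simp: shifted_def)
  then show ?thesis by (metis assms spectral_mat_rank rank_gram)
qed

text \<open>In the eigenbasis, commutation reads (lam_i - lam_j) D_ij = 0, so D is diagonal because
  the eigenvalues are distinct; the quadratic equation becomes lam_i d_i = d_i^2 + \<tau> d_i and
  leaves d_i = 0 or d_i = lam_i - \<tau>.\<close>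

lemma P_fixes_imp_shifted:
  fixes W :: "real^'m^'n"
  assumes "P W ** W = W"
  obtains J where "\<And>j. j \<in> J \<Longrightarrow> \<tau> < lam $ j" "W ** transpose W = spectral_mat (shifted J)"
proof -
  define M where "M = W ** transpose W"
  define D where "D = transpose \<Omega> ** M ** \<Omega>"
  have M: "spectral_mat lam ** M = M ** M + \<tau> *\<^sub>R M" "spectral_mat lam ** M = M ** spectral_mat lam"
    using P_fixes_imp_gram_eq[OF assms] by (simp_all add: M_def)
  have co: "transpose \<Omega> ** (B ** C) ** \<Omega> = (transpose \<Omega> ** B ** \<Omega>) ** (transpose \<Omega> ** C ** \<Omega>)" for B C
  proof -
    have "(transpose \<Omega> ** B ** \<Omega>) ** (transpose \<Omega> ** C ** \<Omega>) = transpose \<Omega> ** B ** (\<Omega> ** transpose \<Omega>) ** C ** \<Omega>"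
      by (simp only: matrix_mul_assoc)
    then show ?thesis by (simp add: OO matrix_mul_assoc)
  qed
  have comm: "diag lam ** D = D ** diag lam"
    using arg_cong[OF M(2), of "\<lambda>B. transpose \<Omega> ** B ** \<Omega>"] unfolding co diag_conj D_def .
  have "D $ i $ j = 0" if "i \<noteq> j" for i j
  proof -
    have "lam $ i * D $ i $ j = D $ i $ j * lam $ j"
      using comm by (metis diag_mult_nth mult_diag_nth)
    with that lam_inj show ?thesis by (auto simp: algebra_simps)
  qed
  then have Dd: "D = diag (\<chi> i. D $ i $ i)" by (auto simp: vec_eq_iff diag_nth)
  define d where "d = (\<chi> i. D $ i $ i)"
  have Mc: "M = spectral_mat d" using Dd unfolding D_def d_def by (rule spectral_mat_diag)
  have "spectral_mat (lam * d) = spectral_mat (d * d) + spectral_mat (\<chi> i. \<tau>) ** spectral_mat d"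
  proof -
    have "spectral_mat (\<chi> i. \<tau>) ** spectral_mat d = \<tau> *\<^sub>R spectral_mat d"
      by (simp add: spectral_mat_const mat_eq_scaleR[of \<tau>] matrix_mult_scaleR_left)
    then show ?thesis using M(1) by (simp add: Mc spectral_mat_mult)
  qed
  then have "lam * d = d * d + (\<chi> i. \<tau>) * d" by (simp add: spectral_mat_mult spectral_mat_add spectral_mat_inject)
  then have de: "lam $ i * d $ i = d $ i * d $ i + \<tau> * d $ i" for i
    by (metis vector_add_component vector_mult_component vec_lambda_beta)
  have d0: "0 \<le> d $ i" for i
  proof -
    have "D = (transpose \<Omega> ** W) ** transpose (transpose \<Omega> ** W)"
      by (simp add: D_def M_def matrix_transpose_mul matrix_mul_assoc)
    then show ?thesis by (simp add: d_def matrix_matrix_mult_def transpose_def sum_nonneg)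
  qed
  \<comment> \<open>Taking exactly the nonzero eigenvalues makes \<tau> < lam_j strict on
    \<open>J\<close>, since lam_j - \<tau> is nonnegative and not zero.\<close>
  define J where "J = {i. d $ i \<noteq> 0}"
  have dJ: "d $ i = lam $ i - \<tau>" if "i \<in> J" for i
    using de[of i] that by (simp add: J_def flip: distrib_right) 
  have "\<tau> < lam $ j" if "j \<in> J" for j
    using dJ[OF that] d0[of j] that by (auto simp: J_def)
  moreover have "d = shifted J" using dJ by (auto simp: shifted_def vec_eq_iff J_def)
  ultimately show ?thesis by (intro that[of J]) (use Mc in \<open>auto simp: M_def\<close>)
qed

end

subsection \<open>Minimisers of bounded rank\<close>

lemma bounded_bilinear_matrix_vector_mult:
  "bounded_bilinear ((*v) :: real^'m^'n \<Rightarrow> real^'m \<Rightarrow> real^'n)"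
  unfolding bilinear_conv_bounded_bilinear[symmetric] bilinear_def
  by (auto intro!: linearI simp: matrix_vector_right_distrib matrix_vector_mult_add_rdistrib
      matrix_vector_mult_scaleR scaleR_matrix_vector_assoc)

text \<open>Lower semicontinuity of the rank: \<open>W\<close> is bounded below by e on its row
  space, and a matrix within e / K of \<open>W\<close> stays injective there, so its rank is at
  least that of \<open>W\<close>.\<close>

lemma closed_bounded_rank: "closed (bounded_rank k :: (real^'m^'n) set)"
proof -
  have "\<exists>e>0. \<forall>W'. dist W' W < e \<longrightarrow> W' \<notin> bounded_rank k" if "W \<notin> bounded_rank k" for W :: "real^'m^'n"
  proof -
    let ?R = "range ((*v) (transpose W))"
    have sub: "subspace ?R" by (intro linear_subspace_image matrix_vector_mul_linear) simp
    obtain e where e: "0 < e" "\<And>x. x \<in> ?R \<Longrightarrow> e * norm x \<le> norm (W *v x)"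
      using row_space_kernel_trivial
        injective_imp_isometric[OF closed_subspace[OF sub] sub matrix_vector_mul_bounded_linear[of W]]
      by (metis norm_zero)
    obtain K where K: "0 < K" "\<And>(M :: real^'m^'n) x. norm (M *v x) \<le> norm M * norm x * K"
      using bounded_bilinear.pos_bounded[OF bounded_bilinear_matrix_vector_mult] by metis
    have "W' \<notin> bounded_rank k" if d: "dist W' W < e / K" for W'
    proof -
      have KW: "norm (W' - W) * K < e" using d K(1) by (simp add: dist_norm field_simps)
      have inj: "x = 0" if x: "x \<in> ?R" "W' *v x = 0" for x
      proof (rule ccontr)
        assume "x \<noteq> 0"
        have "e * norm x \<le> norm (W *v x)" by (rule e(2)[OF x(1)])
        also have "\<dots> = norm ((W' - W) *v x)" using x(2) by (simp add: matrix_vector_mult_diff_rdistrib)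
        also have "\<dots> \<le> norm (W' - W) * norm x * K" by (rule K(2))
        also have "\<dots> = (norm (W' - W) * K) * norm x" by simp
        also have "\<dots> < e * norm x" using \<open>x \<noteq> 0\<close> by (intro mult_strict_right_mono KW) simp
        finally show False by simp
      qed
      from sub inj have "dim ((*v) W' ` ?R) = dim ?R" by (rule dim_image_trivial_kernel)
      also have "\<dots> = rank W" by (metis rank_dim_range rank_transpose)
      also have "rank W > k" using \<open>W \<notin> bounded_rank k\<close> by (simp add: bounded_rank_def)
      finally have "k < dim ((*v) W' ` ?R)" .
      also have "\<dots> \<le> rank W'" unfolding rank_dim_range by (intro dim_subset) auto
      finally show ?thesis by (simp add: bounded_rank_def)
    qed
    then show ?thesis using e(1) K(1) by (intro exI[of _ "e / K"]) auto
  qed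
  then show ?thesis unfolding closed_def open_dist by auto
qed

context perturbed_bures
begin

text \<open>Coercivity: trace (S W) contains |W|^2, while trace (X W) grows at most linearly,
  because |X|^2 = trace (ASA) = |AW|^2 + \<tau> trace \<open>\<Sigma>\<^sub>0\<close>.\<close>

lemma L1_lower_bound:
  obtains a b where "0 \<le> a" "0 \<le> b" "\<And>W :: real^'m^'n. (norm W)\<^sup>2 - a * norm W - b \<le> L1 \<tau> \<Sigma>\<^sub>0 W"
proof -
  obtain K1 where K1: "0 \<le> K1" "\<And>M :: real^'n^'n. norm (trace M) \<le> norm M * K1"
    using bounded_linear.nonneg_bounded[OF bounded_linear_trace] by blast
  obtain K2 where K2: "0 \<le> K2" "\<And>W :: real^'m^'n. norm (A ** W) \<le> norm W * K2"
    using bounded_linear.nonneg_bounded[OF bounded_bilinear.bounded_linear_right[OF bounded_bilinear_matrix_mult]]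
    by metis
  have S: "S W = W ** transpose W + \<tau> *\<^sub>R mat 1" for W :: "real^'m^'n" by (simp add: S_def mat_eq_scaleR[of \<tau>])
  have trg: "trace (W ** transpose W) = (norm W)\<^sup>2" for W :: "real^'m^'n"
    by (metis trace_mul_sym inner_matrix dot_square_norm)
  \<comment> \<open>\<open>c\<close> absorbs the part of |X|^2 that does not depend on W; the
    absolute value spares an argument on the sign of the trace.\<close>
  define c where "c = sqrt \<bar>\<tau> * trace \<Sigma>\<^sub>0\<bar>"
  have X: "norm (X W) \<le> norm W * K2 + c" for W :: "real^'m^'n"
  proof -
    have "(norm (X W))\<^sup>2 = trace (X W ** X W)"
      by (metis trg X_sym dot_square_norm inner_matrix)
    also have "\<dots> = trace ((A ** W) ** transpose (A ** W)) + \<tau> * trace \<Sigma>\<^sub>0"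
      by (simp add: XX S matrix_add_ldistrib matrix_add_rdistrib matrix_mult_scaleR_left
          matrix_mult_scaleR_right trace_add trace_scaleR matrix_transpose_mul A_sym matrix_mul_assoc AA)
    also have "trace ((A ** W) ** transpose (A ** W)) = (norm (A ** W))\<^sup>2" by (rule trg)
    also have "(norm (A ** W))\<^sup>2 + \<tau> * trace \<Sigma>\<^sub>0 \<le> (norm W * K2)\<^sup>2 + c\<^sup>2"
      using power_mono[OF K2(2), of W 2] by (simp add: c_def)
    also have "\<dots> \<le> (norm W * K2 + c)\<^sup>2"
      using K2(1) by (simp add: power2_sum c_def)
    finally show ?thesis
      by (rule power2_le_imp_le) (simp add: K2(1) c_def)
  qed
  have "(norm W)\<^sup>2 - (2 * K1 * K2) * norm W - (2 * K1 * c + \<bar>trace \<Sigma>\<^sub>0\<bar>) \<le> L1 \<tau> \<Sigma>\<^sub>0 W" for W :: "real^'m^'n"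
  proof -
    have "trace (X W) \<le> norm (X W) * K1" using K1(2)[of "X W"] by simp
    also have "\<dots> \<le> (norm W * K2 + c) * K1" by (intro mult_right_mono X K1)
    finally have "2 * trace (X W) \<le> (2 * K1 * K2) * norm W + 2 * K1 * c" by (simp add: algebra_simps)
    moreover have "trace (S W) \<ge> (norm W)\<^sup>2"
      using tau_pos by (simp add: S trace_add trace_scaleR trg trace_I)
    ultimately show ?thesis unfolding L1_eq by linarith
  qed
  then show ?thesis using K1(1) K2(1) by (intro that[of "2 * K1 * K2" "2 * K1 * c + \<bar>trace \<Sigma>\<^sub>0\<bar>"]) (auto simp: c_def)
qed

lemma L1_attains_min_bounded_rank:
  "\<exists>W :: real^'m^'n. is_arg_min (L1 \<tau> \<Sigma>\<^sub>0) (\<lambda>W. W \<in> bounded_rank k) W"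
proof -
  obtain a b where ab: "0 \<le> a" "0 \<le> b"
    and lb: "\<And>W :: real^'m^'n. (norm W)\<^sup>2 - a * norm W - b \<le> L1 \<tau> \<Sigma>\<^sub>0 W"
    by (rule L1_lower_bound) blast
  let ?l = "L1 \<tau> \<Sigma>\<^sub>0 (0 :: real^'m^'n)"
  \<comment> \<open>Beyond this radius r >= 1 and r - a >= b + |l| + 1, so the lower bound for the
    loss exceeds l, its value at 0.\<close>
  define R where "R = a + b + \<bar>?l\<bar> + 1"
  let ?C = "bounded_rank k \<inter> cball 0 R :: (real^'m^'n) set"
  have comp: "compact ?C" by (simp add: closed_bounded_rank closed_Int_compact)
  have zero: "0 \<in> ?C" using ab by (simp add: R_def bounded_rank_def)
  have "continuous_on ?C (L1 \<tau> \<Sigma>\<^sub>0)"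
    using has_derivative_continuous[OF L1_has_derivative] by (blast intro: continuous_at_imp_continuous_on)
  from continuous_attains_inf[OF comp _ this] zero obtain W where
    W: "W \<in> ?C" "\<And>W'. W' \<in> ?C \<Longrightarrow> L1 \<tau> \<Sigma>\<^sub>0 W \<le> L1 \<tau> \<Sigma>\<^sub>0 W'" by blast
  have "L1 \<tau> \<Sigma>\<^sub>0 W \<le> L1 \<tau> \<Sigma>\<^sub>0 W'" if "W' \<in> bounded_rank k" for W' :: "real^'m^'n"
  proof (cases "norm W' \<le> R")
    case True
    with that show ?thesis by (intro W(2)) simp
  next
    case False
    let ?r = "norm W'"
    have "1 * (b + \<bar>?l\<bar> + 1) \<le> ?r * (?r - a)"
      using False ab by (intro mult_mono) (auto simp: R_def)
    then have "?l \<le> ?r\<^sup>2 - a * ?r - b" by (simp add: power2_eq_square algebra_simps)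
    with lb[of W'] W(2)[OF zero] show ?thesis by linarith
  qed
  with W(1) show ?thesis by (auto simp: is_arg_min_linorder)
qed

lemma arg_min_bounded_rank_P_fixes:
  fixes W :: "real^'m^'n"
  assumes "is_arg_min (L1 \<tau> \<Sigma>\<^sub>0) (\<lambda>W. W \<in> bounded_rank k) W"
  shows "P W ** W = W"
proof (rule critical_imp_P_fixes)
  fix K :: "real^'n^'n"
  let ?g = "\<lambda>t. L1 \<tau> \<Sigma>\<^sub>0 (W + t *\<^sub>R (K ** W))"
  have "((\<lambda>t. W + t *\<^sub>R (K ** W)) has_vector_derivative (K ** W)) (at 0)"
    by (auto intro!: derivative_eq_intros)
  from L1_curve_derivative[OF _ this] obtain l where l: "(?g has_real_derivative l) (at 0)"
    by (simp add: o_def)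
  have "?g 0 \<le> ?g t" for t
  proof -
    have "rank ((mat 1 + t *\<^sub>R K) ** W) \<le> rank W" by (rule rank_mul_le_right)
    then have "W + t *\<^sub>R (K ** W) \<in> bounded_rank k"
      using assms by (simp add: is_arg_min_def bounded_rank_def matrix_add_rdistrib matrix_mult_scaleR_left)
    then show ?thesis using assms by (simp add: is_arg_min_linorder)
  qed
  then have "l = 0" by (intro DERIV_local_min[OF l, of 1]) auto
  with l show "(?g has_real_derivative 0) (at 0)" by simp
qed

end

section \<open>Optimal choice of the index set\<close>

context spectral_bures
begin

text \<open>Row i of \<open>G\<close> has at most one nonzero entry, sqrt d_i in column
  \<open>f i\<close>, and \<open>W\<close> is \<Omega> G. Collisions of \<open>f\<close> outside the
  support of \<open>d\<close> are harmless because those rows vanish.\<close>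

lemma gram_conj_exists:
  fixes d :: "real^'n"
  assumes d0: "\<And>i. 0 \<le> d $ i" and card: "card {i. d $ i \<noteq> 0} \<le> CARD('m)"
  obtains W :: "real^'m^'n" where "W ** transpose W = spectral_mat d"
proof -
  from card obtain f :: "'n \<Rightarrow> 'm" where f: "inj_on f {i. d $ i \<noteq> 0}"
    using card_le_inj[of "{i. d $ i \<noteq> 0}" "UNIV :: 'm set"] by auto
  define G :: "real^'m^'n" where "G = (\<chi> i c. if c = f i then sqrt (d $ i) else 0)"
  have "(\<Sum>c\<in>UNIV. G $ i $ c * G $ j $ c) = (if i = j then d $ i else 0)" for i j
  proof -
    have "(\<Sum>c\<in>UNIV. G $ i $ c * G $ j $ c) = (\<Sum>c\<in>UNIV. if c = f i then sqrt (d $ i) * G $ j $ c else 0)"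
      by (intro sum.cong) (auto simp: G_def)
    also have "\<dots> = sqrt (d $ i) * G $ j $ f i" by simp
    also have "\<dots> = (if i = j then d $ i else 0)"
      using d0[of i] f by (auto simp: G_def inj_on_def)
    finally show ?thesis .
  qed
  then have GG: "G ** transpose G = diag d"
    by (simp add: vec_eq_iff matrix_matrix_mult_def transpose_def diag_nth)
  have "(\<Omega> ** G) ** transpose (\<Omega> ** G) = \<Omega> ** (G ** transpose G) ** transpose \<Omega>"
    by (simp only: matrix_transpose_mul matrix_mul_assoc)
  also have "\<dots> = spectral_mat d" by (simp only: GG spectral_mat_def)
  finally show ?thesis by (rule that)
qed

text \<open>By how much the loss drops when \<open>j\<close> joins the index set.\<close>

definition weight :: "'n \<Rightarrow> real" where "weight j = (sqrt (lam $ j) - sqrt \<tau>)\<^sup>2"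

text \<open>Weights increase with the eigenvalue only from \<tau> upwards, hence the lower bound on
  the smaller one.\<close>

lemma weight_less: "\<tau> \<le> lam $ i \<Longrightarrow> lam $ i < lam $ j \<Longrightarrow> weight i < weight j"
  unfolding weight_def using tau by (intro power_strict_mono) auto

lemma weight_pos: "\<tau> < lam $ j \<Longrightarrow> 0 < weight j"
  by (simp add: weight_def)

text \<open>If \<open>J\<close> lies in \<open>F\<close>, whatever is missing from the right-hand
  set has positive weight. If not, an index of \<open>J\<close> outside \<open>F\<close> exceeds
  \<tau>, hence so does all of \<open>F\<close>, and indices can be exchanged: weights on J - F are
  at most m, weights on \<open>F\<close> are above m, and F - J has at least as many elements as J -
  F.\<close>

lemma sum_weight_less:
  assumes top: "\<And>i j. i \<in> F \<Longrightarrow> j \<notin> F \<Longrightarrow> lam $ j < lam $ i"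
    and J: "\<And>j. j \<in> J \<Longrightarrow> \<tau> < lam $ j" "card J \<le> card F"
    and ne: "J \<noteq> {j\<in>F. \<tau> < lam $ j}"
  shows "sum weight J < sum weight {j\<in>F. \<tau> < lam $ j}"
proof (cases "J \<subseteq> F")
  case True
  let ?O = "{j\<in>F. \<tau> < lam $ j}"
  have sub: "J \<subseteq> ?O" using True J(1) by auto
  have "0 < sum weight (?O - J)" using ne sub by (intro sum_pos) (auto intro: weight_pos)
  moreover have "sum weight ?O = sum weight (?O - J) + sum weight J" using sub by (intro sum.subset_diff) auto
  ultimately show ?thesis by simp
next
  case False
  define m where "m = Max (weight ` (J - F))"
  have fin: "finite (weight ` (J - F))" and nonempty: "weight ` (J - F) \<noteq> {}" using False by auto
  have le: "weight j \<le> m" if "j \<in> J - F" for j using that fin by (simp add: m_def)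
  obtain j1 where j1: "j1 \<in> J - F" "m = weight j1" using Max_in[OF fin nonempty] by (auto simp: m_def)
  have less: "m < weight i" if "i \<in> F" for i
    using j1 that J(1)[of j1] top[of i j1] by (auto intro!: weight_less)
  have opt: "{j\<in>F. \<tau> < lam $ j} = F"
    using j1(1) J(1)[of j1] top[of _ j1] by (auto intro: less_trans)
  have c1: "card J = card (J - F) + card (J \<inter> F)" "card F = card (F - J) + card (J \<inter> F)"
    by (simp_all add: card_Diff_subset_Int Int_commute card_mono)
  have cle: "card (J - F) \<le> card (F - J)" using c1 J(2) by linarith
  moreover have "card (J - F) > 0" using j1(1) by (auto simp: card_gt_0_iff)
  ultimately have "0 < card (F - J)" by linarith
  then have neF: "F - J \<noteq> {}" by (metis card.empty less_irrefl)
  have m0: "0 \<le> m" using j1(2) by (simp add: weight_def)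
  have "sum weight (J - F) \<le> real (card (J - F)) * m" using le by (rule sum_bounded_above)
  also have "\<dots> \<le> real (card (F - J)) * m" using cle m0 by (intro mult_right_mono) auto
  also have "\<dots> = (\<Sum>i\<in>F - J. m)" by simp
  also have "\<dots> < sum weight (F - J)" using neF less by (intro sum_strict_mono) auto
  finally have "sum weight (J - F) + sum weight (J \<inter> F) < sum weight (F - J) + sum weight (F \<inter> J)" by (simp add: Int_commute)
  also have "sum weight (J - F) + sum weight (J \<inter> F) = sum weight J" by (simp add: sum.Int_Diff[of J weight F])
  also have "sum weight (F - J) + sum weight (F \<inter> J) = sum weight F" by (simp add: sum.Int_Diff[of F weight J])
  finally show ?thesis by (simp only: opt)
qed

text \<open>A minimiser has the Gram matrix of some index set, and a matrix W0 realising the claimed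
  set would beat any other. Conversely, all matrices with the right Gram matrix share the value of a
  minimiser; this is where existence of one enters.\<close>

lemma arg_min_bounded_rank_iff:
  fixes W :: "real^'m^'n"
  assumes top: "\<And>i j. i \<in> F \<Longrightarrow> j \<notin> F \<Longrightarrow> lam $ j < lam $ i" and F: "card F \<le> CARD('m)"
  shows "is_arg_min (L1 \<tau> (spectral_mat lam)) (\<lambda>W. W \<in> bounded_rank (card F)) W
    \<longleftrightarrow> W ** transpose W = spectral_mat (shifted {j\<in>F. \<tau> < lam $ j})" (is "?min W \<longleftrightarrow> ?gram W")
proof -
  let ?O = "{j\<in>F. \<tau> < lam $ j}"
  have Oset: "{i. shifted ?O $ i \<noteq> 0} \<subseteq> F" by (auto simp: shifted_def)
  have "card {i. shifted ?O $ i \<noteq> 0} \<le> CARD('m)"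
    using card_mono[OF _ Oset] F by auto
  moreover have "0 \<le> shifted ?O $ i" for i by (simp add: shifted_def)
  ultimately obtain W0 :: "real^'m^'n" where W0: "?gram W0" by (metis gram_conj_exists)
  have rk: "M \<in> bounded_rank (card F)" if "?gram M" for M :: "real^'m^'n"
    unfolding bounded_rank_def mem_Collect_eq rank_shifted[OF that] by (intro card_mono) auto
  have val: "L1 \<tau> (spectral_mat lam) M = sum weight UNIV - sum weight J"
    if "M ** transpose M = spectral_mat (shifted J)" "\<And>j. j \<in> J \<Longrightarrow> \<tau> \<le> lam $ j" for M :: "real^'m^'n" and J
  proof -
    have "L1 \<tau> (spectral_mat lam) M = sum weight (UNIV - J)"
      using that(2) by (simp add: L1_shifted[OF that(1)] weight_def Compl_eq_Diff_UNIV)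
    then show ?thesis by (simp add: sum_diff)
  qed
  have *: "?gram M" if min: "?min M" for M :: "real^'m^'n"
  proof -
    obtain J where J: "\<And>j. j \<in> J \<Longrightarrow> \<tau> < lam $ j" "M ** transpose M = spectral_mat (shifted J)"
      using P_fixes_imp_shifted[OF arg_min_bounded_rank_P_fixes[OF min]] by blast
    have "J = ?O"
    proof (rule ccontr)
      assume ne: "J \<noteq> ?O"
      have "{j \<in> J. lam $ j \<noteq> \<tau>} = J" using J(1) by force
      then have "card J = rank M" using rank_shifted[OF J(2)] by simp
      then have "card J \<le> card F" using that by (simp add: is_arg_min_def bounded_rank_def)
      from sum_weight_less[OF top J(1) this ne] have "sum weight J < sum weight ?O" .
      then have "L1 \<tau> (spectral_mat lam) W0 < L1 \<tau> (spectral_mat lam) M"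
        using val[OF W0] val[OF J(2)] J(1) by (simp add: less_imp_le)
      with rk[OF W0] that show False by (auto simp: is_arg_min_def)
    qed
    with J(2) show ?thesis by simp
  qed
  obtain W1 :: "real^'m^'n" where W1: "?min W1" using L1_attains_min_bounded_rank by blast
  show ?thesis
  proof
    assume W: "?gram W"
    have "L1 \<tau> (spectral_mat lam) W = L1 \<tau> (spectral_mat lam) W1"
      using val[OF W] val[OF *[OF W1]] by simp
    with W1 rk[OF W] show "?min W" by (simp add: is_arg_min_linorder)
  qed (rule *)
qed

text \<open>When some index of \<open>F\<close> has lam_j <= \<tau>, the minimiser \<open>W\<close>
  has rank below \<open>card F\<close>, so its value has to be approached from outside by matrices
  of the exact rank.\<close>

lemma arg_min_bounded_rank_INF:
  fixes W :: "real^'m^'n"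
  assumes top: "\<And>i j. i \<in> F \<Longrightarrow> j \<notin> F \<Longrightarrow> lam $ j < lam $ i" and F: "card F \<le> CARD('m)"
    and W: "is_arg_min (L1 \<tau> (spectral_mat lam)) (\<lambda>W. W \<in> bounded_rank (card F)) W"
  shows "(INF W' \<in> fixed_rank (card F) :: (real^'m^'n) set. L1 \<tau> (spectral_mat lam) W') = L1 \<tau> (spectral_mat lam) W"
proof -
  let ?L = "L1 \<tau> (spectral_mat lam) :: real^'m^'n \<Rightarrow> real"
  let ?O = "{j\<in>F. \<tau> < lam $ j}"
  \<comment> \<open>The shift by \<open>e\<close> makes the rank exactly \<open>card F\<close>; the value tends to the minimum as \<open>e\<close> goes to \<open>0\<close>.\<close>
  define d where "d e = (\<chi> i. if i \<in> F then max (lam $ i - \<tau>) 0 + e else 0)" for e :: real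
  have d0: "0 \<le> d e $ i" if "0 \<le> e" for e i using that by (simp add: d_def)
  have supp: "{i. d e $ i \<noteq> 0} = F" if "0 < e" for e using that by (auto simp: d_def)
  have "d 0 = shifted ?O" by (auto simp: d_def shifted_def vec_eq_iff)
  then have gram: "W ** transpose W = spectral_mat (d 0)"
    using arg_min_bounded_rank_iff[OF top F, of W] W by simp
  have lower: "?L W \<le> ?L W'" if "W' \<in> fixed_rank (card F)" for W'
    using W that by (simp add: is_arg_min_linorder bounded_rank_def fixed_rank_def)
  have bdd: "bdd_below (?L ` fixed_rank (card F))" using lower by (intro bdd_belowI2)
  have "\<exists>V :: real^'m^'n. V \<in> fixed_rank (card F) \<and> ?L V = (\<Sum>i\<in>UNIV. (sqrt (lam $ i) - sqrt (d e $ i + \<tau>))\<^sup>2)"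
    if e: "0 < e" for e
  proof -
    have "card {i. d e $ i \<noteq> 0} \<le> CARD('m)" using F by (simp add: supp[OF e])
    from gram_conj_exists[OF d0 this] e obtain V :: "real^'m^'n" where V: "V ** transpose V = spectral_mat (d e)"
      by (metis less_imp_le)
    have "rank V = card F" by (metis V spectral_mat_rank rank_gram supp[OF e])
    with L1_spectral[OF V d0] e show ?thesis by (intro exI[of _ V]) (simp add: fixed_rank_def)
  qed
  then obtain V where V: "\<And>e. 0 < e \<Longrightarrow> V e \<in> fixed_rank (card F)"
    "\<And>e. 0 < e \<Longrightarrow> ?L (V e) = (\<Sum>i\<in>UNIV. (sqrt (lam $ i) - sqrt (d e $ i + \<tau>))\<^sup>2)"
    by metis
  show ?thesis
  proof (rule antisym)
    let ?e = "\<lambda>n. inverse (real (Suc n))"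
    have "(\<lambda>n. (sqrt (lam $ i) - sqrt (d (?e n) $ i + \<tau>))\<^sup>2) \<longlonglongrightarrow> (sqrt (lam $ i) - sqrt (d 0 $ i + \<tau>))\<^sup>2" for i
    proof -
      have "(\<lambda>n. d (?e n) $ i) \<longlonglongrightarrow> d 0 $ i"
        using tendsto_add[OF tendsto_const LIMSEQ_inverse_real_of_nat, of "max (lam $ i - \<tau>) 0"]
        by (cases "i \<in> F") (simp_all add: d_def)
      then show ?thesis
        by (intro tendsto_power tendsto_diff tendsto_const tendsto_real_sqrt tendsto_add)
    qed
    then have "(\<lambda>n. \<Sum>i\<in>UNIV. (sqrt (lam $ i) - sqrt (d (?e n) $ i + \<tau>))\<^sup>2)
        \<longlonglongrightarrow> (\<Sum>i\<in>UNIV. (sqrt (lam $ i) - sqrt (d 0 $ i + \<tau>))\<^sup>2)" by (intro tendsto_sum)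
    then have "(\<lambda>n. ?L (V (?e n))) \<longlonglongrightarrow> ?L W"
      by (simp add: V(2) L1_spectral[OF gram d0])
    then show "(INF W' \<in> fixed_rank (card F). ?L W') \<le> ?L W"
      by (rule LIMSEQ_le_const) (auto intro!: cINF_lower bdd V(1))
    show "?L W \<le> (INF W' \<in> fixed_rank (card F). ?L W')"
      using V(1)[of 1] by (intro cINF_greatest lower) auto
  qed
qed

end

subsection \<open>Spectral points\<close>

text \<open>The position of an element, counted from 0; it matches finite ordered types that carry
  no enumeration of their own.\<close>

lemma bij_betw_rank:
  fixes S :: "'a::{finite,linorder} set"
  shows "bij_betw (\<lambda>x. card {y\<in>S. y < x}) S {..<card S}"
proof -
  have less: "card {z\<in>S. z < x} < card {z\<in>S. z < y}" if "x \<in> S" "x < y" for x y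
    using that by (intro psubset_card_mono) (auto intro: less_trans)
  have inj: "inj_on (\<lambda>x. card {y\<in>S. y < x}) S"
  proof (rule inj_onI)
    fix x y assume "x \<in> S" "y \<in> S" "card {z\<in>S. z < x} = card {z\<in>S. z < y}"
    then show "x = y" using less[of x y] less[of y x] by (cases x y rule: linorder_cases) auto
  qed
  have "(\<lambda>x. card {y\<in>S. y < x}) ` S \<subseteq> {..<card S}"
    by (auto intro!: psubset_card_mono)
  then have "(\<lambda>x. card {y\<in>S. y < x}) ` S = {..<card S}"
    by (rule card_subset_eq[rotated]) (simp_all add: card_image[OF inj])
  with inj show ?thesis by (simp add: bij_betw_def)
qed

text \<open>Elements of the index type are matched with elements of \<open>J\<close> at the same
  position. A strictly monotone map onto \<open>J\<close> preserves positions, hence is unique, and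
  the definite description denotes.\<close>

lemma enum_set:
  fixes J :: "'n::{finite,linorder} set"
  assumes card: "card J = CARD('k::{finite,linorder})"
  shows "inj (enum_set J :: 'k \<Rightarrow> 'n)" "range (enum_set J :: 'k \<Rightarrow> 'n) = J"
proof -
  define rJ where "rJ x = card {y\<in>J. y < x}" for x
  define rk where "rk a = card {b::'k. b < a}" for a
  have bJ: "bij_betw rJ J {..<card J}" unfolding rJ_def[abs_def] by (rule bij_betw_rank)
  have bk: "bij_betw rk UNIV {..<card J}" using bij_betw_rank[of "UNIV :: 'k set"] by (simp add: rk_def[abs_def] card)
  define e where "e a = inv_into J rJ (rk a)" for a
  have rkJ: "rk a \<in> rJ ` J" for a using bJ bk by (auto simp: bij_betw_def)
  have eJ: "e a \<in> J" "rJ (e a) = rk a" for a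
    using rkJ[of a] by (auto simp: e_def inv_into_into f_inv_into_f)
  have mono: "strict_mono e"
  proof (rule strict_monoI)
    fix a b :: 'k assume "a < b"
    then have lt: "rk a < rk b" unfolding rk_def by (intro psubset_card_mono) (auto intro: less_trans)
    show "e a < e b"
    proof (rule ccontr)
      assume "\<not> e a < e b"
      then have "rJ (e b) \<le> rJ (e a)" unfolding rJ_def by (intro card_mono) auto
      with lt eJ(2) show False by simp
    qed
  qed
  have "card (range e) = card J" using card by (simp add: card_image strict_mono_imp_inj_on[OF mono])
  then have range: "range e = J" using eJ(1) by (intro card_subset_eq) auto
  have unique: "e' = e" if e': "strict_mono e'" "range e' = J" for e' :: "'k \<Rightarrow> 'n"
  proof
    fix a
    have "{y\<in>J. y < e' a} = e' ` {b. b < a}"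
      using e' strict_mono_less[OF e'(1)] by auto
    then have "rJ (e' a) = rk a"
      by (simp add: rJ_def rk_def card_image strict_mono_imp_inj_on[OF e'(1)])
    then show "e' a = e a" using bJ eJ e'(2) by (metis bij_betw_def inj_onD rangeI)
  qed
  have "enum_set J = e"
    unfolding enum_set_def using mono range unique by (intro the_equality conjI) blast+
  with range strict_mono_imp_inj_on[OF mono] show "inj (enum_set J :: 'k \<Rightarrow> 'n)" "range (enum_set J :: 'k \<Rightarrow> 'n) = J"
    by simp_all
qed

lemma card_first_indices:
  assumes "k \<le> CARD('n::{finite,linorder})"
  shows "card (first_indices k :: 'n set) = k"
proof -
  let ?r = "\<lambda>x::'n. card {y. y < x}"
  have b: "bij_betw ?r UNIV {..<CARD('n)}" using bij_betw_rank[of "UNIV :: 'n set"] by simp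
  \<comment> \<open>\<open>{..i}\<close> contains \<open>i\<close> itself, so the bound
    \<open>\<le> k\<close> in the definition means position below k when counting from 0.\<close>
  have "card {..i} = Suc (?r i)" for i :: 'n
  proof -
    have "{..i} = insert i {y. y < i}" by auto
    then show ?thesis by simp
  qed
  then have F: "(first_indices k :: 'n set) = {i. ?r i < k}" by (auto simp: first_indices_def)
  have "?r ` first_indices k = {..<k}"
  proof (intro equalityI subsetI)
    fix l assume l: "l \<in> {..<k}"
    with assms b have "l \<in> ?r ` UNIV" by (auto simp: bij_betw_def)
    with l show "l \<in> ?r ` first_indices k" by (auto simp: F)
  qed (auto simp: F)
  moreover have "inj_on ?r (first_indices k)" using b by (auto simp: bij_betw_def intro: inj_on_subset)
  ultimately show ?thesis by (metis card_image card_lessThan)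
qed

lemma first_indices_less:
  assumes "i \<in> first_indices k" "j \<notin> first_indices k"
  shows "i < j"
proof (rule ccontr)
  assume "\<not> i < j"
  then have "card {..j} \<le> card {..i}" by (intro card_mono) auto
  with assms show False by (simp add: first_indices_def)
qed

text \<open>Vectors with \<delta> a = 0 vanish and cannot be normalised; this happens at indices
  with lam_j = \<tau>. Their \<open>u a\<close> come from an orthonormal basis of the complement of
  the others, which is large enough because the family has at most as many members as the
  dimension.\<close>

lemma orthogonal_family_normalise:
  fixes g :: "'k::finite \<Rightarrow> real^'m"
  assumes g: "\<And>a b. g a \<bullet> g b = (if a = b then \<delta> a else 0)" and card: "CARD('k) \<le> CARD('m)"
  obtains u where "\<And>a b. u a \<bullet> u b = (if a = b then 1 else 0)" "\<And>a. g a = sqrt (\<delta> a) *\<^sub>R u a"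
proof -
  have d0: "0 \<le> \<delta> a" for a using g[of a a] by (metis inner_ge_zero)
  define N where "N = {a. \<delta> a \<noteq> 0}"
  define u0 where "u0 a = g a /\<^sub>R sqrt (\<delta> a)" for a
  have u0: "u0 a \<bullet> u0 b = (if a = b then 1 else 0)" if "a \<in> N" "b \<in> N" for a b
    using that d0[of a] by (auto simp: u0_def g N_def divide_simps)
  have inj: "inj_on u0 N" using u0 by (metis inj_onI zero_neq_one)
  let ?A = "span (u0 ` N)"
  let ?C = "{y. \<forall>x\<in>?A. orthogonal x y}"
  have indep: "independent (u0 ` N)"
  proof (rule pairwise_orthogonal_independent)
    show "pairwise orthogonal (u0 ` N)" using u0 inj by (auto simp: pairwise_def orthogonal_def inj_on_eq_iff)
    show "0 \<notin> u0 ` N" using u0 by force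
  qed
  have "dim {y \<in> UNIV. \<forall>x\<in>?A. orthogonal x y} + dim ?A = dim (UNIV :: (real^'m) set)"
    by (rule dim_subspace_orthogonal_to_vectors) auto
  then have "dim ?C + card N = CARD('m)"
    using indep inj by (simp add: dim_eq_card_independent card_image)
  moreover have "card N + card (-N) = CARD('k)" by (subst card_Un_disjoint[symmetric]) auto
  ultimately have le: "card (-N) \<le> dim ?C" using card by linarith
  have subC: "subspace ?C" by (auto simp: subspace_def orthogonal_def inner_add_right)
  obtain B where B: "B \<subseteq> ?C" "pairwise orthogonal B" "\<And>x. x \<in> B \<Longrightarrow> norm x = 1"
    "independent B" "card B = dim ?C" "span B = ?C"
    by (rule orthonormal_basis_subspace[OF subC]) blast
  have "finite B" using B(4) by (rule independent_imp_finite)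
  with le B(5) obtain f where f: "f ` (-N) \<subseteq> B" "inj_on f (-N)" using card_le_inj[of "-N" B] by auto
  define u where "u a = (if a \<in> N then u0 a else f a)" for a
  have cross: "u0 a \<bullet> f b = 0" if "a \<in> N" "b \<notin> N" for a b
    using that f(1) B(1) by (auto simp: orthogonal_def span_base image_subset_iff)
  have "f a \<bullet> f b = (if a = b then 1 else 0)" if "a \<notin> N" "b \<notin> N" for a b
    using that f B(2) B(3)[of "f a"]
    by (auto simp: pairwise_def orthogonal_def inj_on_eq_iff image_subset_iff dot_square_norm)
  then have "u a \<bullet> u b = (if a = b then 1 else 0)" for a b
    using u0 cross by (auto simp: u_def inner_commute)
  moreover have "g a = sqrt (\<delta> a) *\<^sub>R u a" for a
    using g[of a a] by (cases "a \<in> N") (auto simp: u_def u0_def N_def)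
  ultimately show ?thesis by (rule that)
qed

lemma matrix_mult_nth: "(B ** C) $ i $ j = (\<Sum>a\<in>UNIV. B $ i $ a * C $ a $ j)"
  by (simp add: matrix_matrix_mult_def)

lemma inner_column: "transpose V ** V = mat 1 \<longleftrightarrow> (\<forall>a b. column a V \<bullet> column b V = (if a = b then 1 else 0))"
  for V :: "real^'k^'m"
  by (simp add: vec_eq_iff matrix_matrix_mult_def transpose_def mat_def column_def inner_vec_def)

section \<open>Spectral points and matrices with prescribed Gram matrix\<close>

locale ordered_spectral_bures = spectral_bures \<tau> \<Omega> lam
  for \<tau> :: real and \<Omega> :: "real^'n::{finite,linorder}^'n::_" and lam :: "real^'n::_" +
  assumes lam_anti: "\<And>i j. i < j \<Longrightarrow> lam $ j < lam $ i"
begin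

lemma spectral_point_nth:
  fixes V :: "real^'k::{finite,linorder}^'m"
  assumes J: "card J = CARD('k)" "\<And>j. j \<in> J \<Longrightarrow> \<tau> \<le> lam $ j"
  shows "spectral_point \<tau> \<Omega> (diag lam) J V $ i $ c
    = (\<Sum>a\<in>UNIV. \<Omega> $ i $ enum_set J a * (sqrt (lam $ enum_set J a - \<tau>) * V $ c $ a))"
proof -
  let ?e = "enum_set J :: 'k \<Rightarrow> 'n"
  have e: "inj ?e" "range ?e = J" by (rule enum_set[OF J(1)])+
  have "principal_submatrix (diag lam) J - mat \<tau> = diag (\<chi> a. lam $ ?e a - \<tau>)"
    using e(1) by (auto simp: vec_eq_iff principal_submatrix_def diag_nth mat_def inj_eq)
  moreover have "0 \<le> (\<chi> a. lam $ ?e a - \<tau>) $ a" for a using J(2) e(2) by auto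
  ultimately have m: "msqrt (principal_submatrix (diag lam) J - mat \<tau>) = diag (\<chi> a. sqrt (lam $ ?e a - \<tau>))"
    by (simp add: msqrt_diag)
  show ?thesis
    unfolding spectral_point_def m matrix_mul_assoc[symmetric]
    by (subst matrix_mult_nth) (simp add: diag_mult_nth cols_def transpose_def)
qed

text \<open>The factor \<open>V\<close> cancels through V^T V = I, so the Gram matrix sees only the
  index set.\<close>

lemma spectral_point_gram:
  fixes V :: "real^'k::{finite,linorder}^'m"
  assumes adm: "admissible \<tau> lam J V"
  shows "spectral_point \<tau> \<Omega> (diag lam) J V ** transpose (spectral_point \<tau> \<Omega> (diag lam) J V) = spectral_mat (shifted J)"
proof -
  let ?e = "enum_set J :: 'k \<Rightarrow> 'n"
  have J: "card J = CARD('k)" "\<And>j. j \<in> J \<Longrightarrow> \<tau> \<le> lam $ j" and V: "transpose V ** V = mat 1"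
    using adm by (auto simp: admissible_def)
  have e: "inj ?e" "range ?e = J" by (rule enum_set[OF J(1)])+
  define C :: "real^'k::_^'n::_" where "C = (\<chi> i a. \<Omega> $ i $ ?e a * sqrt (lam $ ?e a - \<tau>))"
  have "spectral_point \<tau> \<Omega> (diag lam) J V = C ** transpose V"
    by (simp add: vec_eq_iff spectral_point_nth[OF J] C_def matrix_matrix_mult_def transpose_def mult.assoc)
  then have "spectral_point \<tau> \<Omega> (diag lam) J V ** transpose (spectral_point \<tau> \<Omega> (diag lam) J V)
      = C ** (transpose V ** V) ** transpose C"
    by (simp only: matrix_transpose_mul matrix_mul_assoc transpose_transpose)
  also have "\<dots> = C ** transpose C" by (simp add: V)
  also have "\<dots> = spectral_mat (shifted J)"
  proof -
    have "(C ** transpose C) $ i $ i' = spectral_mat (shifted J) $ i $ i'" for i i'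
    proof -
      have "(C ** transpose C) $ i $ i' = (\<Sum>a\<in>UNIV. \<Omega> $ i $ ?e a * shifted J $ ?e a * \<Omega> $ i' $ ?e a)"
        unfolding matrix_matrix_mult_def
      proof (simp, rule sum.cong[OF refl])
        fix a
        have "?e a \<in> J" using e(2) by auto
        then show "C $ i $ a * transpose C $ a $ i' = \<Omega> $ i $ ?e a * shifted J $ ?e a * \<Omega> $ i' $ ?e a"
          using J(2)[of "?e a"] by (simp add: C_def transpose_def shifted_def)
      qed
      also have "\<dots> = (\<Sum>j\<in>J. \<Omega> $ i $ j * shifted J $ j * \<Omega> $ i' $ j)"
        using sum.reindex[OF e(1), of "\<lambda>j. \<Omega> $ i $ j * shifted J $ j * \<Omega> $ i' $ j"] by (simp add: e(2))
      also have "\<dots> = (\<Sum>j\<in>UNIV. \<Omega> $ i $ j * shifted J $ j * \<Omega> $ i' $ j)"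
        by (intro sum.mono_neutral_left) (auto simp: shifted_def)
      also have "\<dots> = spectral_mat (shifted J) $ i $ i'"
        unfolding spectral_mat_def by (subst matrix_mult_nth) (simp add: mult_diag_nth transpose_def)
      finally show ?thesis .
    qed
    then show ?thesis by (simp add: vec_eq_iff)
  qed
  finally show ?thesis .
qed

text \<open>The rows of \<Omega>^T W are orthogonal with squared lengths \<open>shifted J\<close>;
  those off \<open>J\<close> vanish, and the others, normalised, become the columns of
  \<open>V\<close>.\<close>

lemma gram_imp_spectral_point:
  fixes W :: "real^'m^'n::_"
  assumes J: "card J = CARD('k::{finite,linorder})" "\<And>j. j \<in> J \<Longrightarrow> \<tau> \<le> lam $ j"
    and k: "CARD('k) \<le> CARD('m)" and gram: "W ** transpose W = spectral_mat (shifted J)"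
  shows "\<exists>V :: real^'k::_^'m. transpose V ** V = mat 1 \<and> W = spectral_point \<tau> \<Omega> (diag lam) J V"
proof -
  let ?e = "enum_set J :: 'k \<Rightarrow> 'n"
  have e: "inj ?e" "range ?e = J" by (rule enum_set[OF J(1)])+
  define G where "G = transpose \<Omega> ** W"
  have WG: "W = \<Omega> ** G" by (simp add: G_def matrix_mul_assoc OO)
  have "G ** transpose G = transpose \<Omega> ** (W ** transpose W) ** \<Omega>"
    by (simp add: G_def matrix_transpose_mul matrix_mul_assoc)
  then have "G ** transpose G = diag (shifted J)" by (simp add: gram diag_conj)
  then have "(G ** transpose G) $ i $ j = (if i = j then shifted J $ i else 0)" for i j
    by (simp add: diag_nth)
  then have GG: "G $ i \<bullet> G $ j = (if i = j then shifted J $ i else 0)" for i j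
    by (simp add: matrix_matrix_mult_def transpose_def inner_vec_def)
  have G0: "G $ j = 0" if "j \<notin> J" for j
    using GG[of j j] that by (simp add: shifted_def)
  have "G $ ?e a \<bullet> G $ ?e b = (if a = b then shifted J $ ?e a else 0)" for a b
    using e(1) by (simp add: GG inj_eq)
  from orthogonal_family_normalise[of "\<lambda>a. G $ ?e a", OF this k] obtain u where
    u: "\<And>a b. u a \<bullet> u b = (if a = b then 1 else 0)" "\<And>a. G $ ?e a = sqrt (shifted J $ ?e a) *\<^sub>R u a" by blast
  define V :: "real^'k::_^'m" where "V = (\<chi> c a. u a $ c)"
  have col: "column a V = u a" for a by (simp add: column_def V_def vec_eq_iff)
  have "transpose V ** V = mat 1" by (simp add: inner_column col u(1))
  moreover have "W $ i $ c = spectral_point \<tau> \<Omega> (diag lam) J V $ i $ c" for i c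
  proof -
    have "W $ i $ c = (\<Sum>j\<in>UNIV. \<Omega> $ i $ j * G $ j $ c)" unfolding WG by (simp add: matrix_matrix_mult_def)
    also have "\<dots> = (\<Sum>j\<in>J. \<Omega> $ i $ j * G $ j $ c)"
      by (intro sum.mono_neutral_right) (auto simp: G0)
    also have "\<dots> = (\<Sum>a\<in>UNIV. \<Omega> $ i $ ?e a * G $ ?e a $ c)"
      using sum.reindex[OF e(1), of "\<lambda>j. \<Omega> $ i $ j * G $ j $ c"] by (simp add: e(2))
    also have "\<dots> = (\<Sum>a\<in>UNIV. \<Omega> $ i $ ?e a * (sqrt (lam $ ?e a - \<tau>) * V $ c $ a))"
    proof (rule sum.cong[OF refl])
      fix a
      have "?e a \<in> J" using e(2) by auto
      then show "\<Omega> $ i $ ?e a * G $ ?e a $ c = \<Omega> $ i $ ?e a * (sqrt (lam $ ?e a - \<tau>) * V $ c $ a)"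
        by (simp add: u(2) V_def shifted_def)
    qed
    finally show ?thesis by (simp only: spectral_point_nth[OF J])
  qed
  ultimately show ?thesis by (intro exI[of _ V]) (auto simp: vec_eq_iff)
qed

lemma first_indices_top:
  "i \<in> first_indices k \<Longrightarrow> j \<notin> first_indices k \<Longrightarrow> lam $ j < lam $ i"
  by (intro lam_anti first_indices_less)

lemma shifted_restrict:
  assumes "\<And>j. j \<in> J \<Longrightarrow> \<tau> \<le> lam $ j"
  shows "shifted {j\<in>J. \<tau> < lam $ j} = shifted J"
  using assms by (force simp: shifted_def vec_eq_iff not_less intro: antisym)

text \<open>\<open>shifted\<close> cannot see indices with lam_j = \<tau>, so equality of index sets
  is not immediate. If some j in \<open>J\<close> is not among the first indices, some i among them
  is missing from \<open>J\<close>, and lam_i > lam_j >= \<tau> makes that difference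
  visible.\<close>

lemma shifted_eq_spec_first_indices_iff:
  assumes J: "card J = k" "\<And>j. j \<in> J \<Longrightarrow> \<tau> \<le> lam $ j"
  shows "shifted J = shifted {j\<in>first_indices k. \<tau> < lam $ j} \<longleftrightarrow> J = first_indices k"
proof -
  let ?F = "first_indices k :: 'n set"
  have "k \<le> CARD('n)" using J(1) by (metis card_mono finite subset_UNIV)
  then have cF: "card ?F = card J" using J(1) by (simp add: card_first_indices)
  show ?thesis
  proof
    assume eq: "shifted J = shifted {j\<in>?F. \<tau> < lam $ j}"
    have iff: "j \<in> J \<longleftrightarrow> j \<in> ?F" if "\<tau> < lam $ j" for j
      using arg_cong[OF eq, of "\<lambda>x. x $ j"] that by (auto simp: shifted_def split: if_splits)
    show "J = ?F"
    proof (rule ccontr)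
      assume "J \<noteq> ?F"
      then have "\<not> J \<subseteq> ?F" using cF by (metis card_subset_eq finite)
      then obtain j where j: "j \<in> J" "j \<notin> ?F" by blast
      then have "\<not> ?F \<subseteq> J" using cF \<open>J \<noteq> ?F\<close> by (metis card_subset_eq finite)
      then obtain i where i: "i \<in> ?F" "i \<notin> J" by blast
      have "\<tau> < lam $ i" using first_indices_top[OF i(1) j(2)] J(2)[OF j(1)] by linarith
      with iff i show False by blast
    qed
  next
    assume "J = ?F"
    then show "shifted J = shifted {j\<in>?F. \<tau> < lam $ j}" using J(2) shifted_restrict[of ?F] by simp
  qed
qed

text \<open>The rank condition stays on the right-hand side because a spectral point with lam_j =
  \<tau> for some j in J has rank below \<open>CARD('k)\<close>.\<close>

lemma critical_point_iff_spectral_point: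
  fixes W :: "real^'m^'n::_"
  assumes "CARD('k::{finite,linorder}) \<le> CARD('m)"
  shows "critical_point_on (L1 \<tau> (spectral_mat lam)) (fixed_rank CARD('k)) W \<longleftrightarrow> W \<in> fixed_rank CARD('k) \<and>
    (\<exists>J. \<exists>V :: real^'k::_^'m. admissible \<tau> lam J V \<and> W = spectral_point \<tau> \<Omega> (diag lam) J V)"
proof safe
  assume "critical_point_on (L1 \<tau> (spectral_mat lam)) (fixed_rank CARD('k)) W"
  then have W: "rank W = CARD('k)" "P W ** W = W" by (simp_all add: critical_point_iff)
  then show "W \<in> fixed_rank CARD('k)" by (simp add: fixed_rank_def)
  obtain J where J: "\<And>j. j \<in> J \<Longrightarrow> \<tau> < lam $ j" "W ** transpose W = spectral_mat (shifted J)"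
    using P_fixes_imp_shifted[OF W(2)] by blast
  have "{j \<in> J. lam $ j \<noteq> \<tau>} = J" using J(1) by force
  then have c: "card J = CARD('k)" using rank_shifted[OF J(2)] W(1) by simp
  have le: "\<tau> \<le> lam $ j" if "j \<in> J" for j using J(1)[OF that] by simp
  from gram_imp_spectral_point[OF c le assms J(2)] c le
  show "\<exists>J. \<exists>V :: real^'k::_^'m. admissible \<tau> lam J V \<and> W = spectral_point \<tau> \<Omega> (diag lam) J V"
    unfolding admissible_def by blast
next
  fix J and V :: "real^'k::_^'m"
  assume adm: "admissible \<tau> lam J V" and r: "spectral_point \<tau> \<Omega> (diag lam) J V \<in> fixed_rank CARD('k)"
  have "P (spectral_point \<tau> \<Omega> (diag lam) J V) ** spectral_point \<tau> \<Omega> (diag lam) J V = spectral_point \<tau> \<Omega> (diag lam) J V"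
    using adm by (intro P_fixes_shifted[OF spectral_point_gram[OF adm]]) (simp add: admissible_def)
  with r show "critical_point_on (L1 \<tau> (spectral_mat lam)) (fixed_rank CARD('k)) (spectral_point \<tau> \<Omega> (diag lam) J V)"
    by (subst critical_point_iff) (simp add: fixed_rank_def)
qed

lemma L1_spectral_point:
  fixes V :: "real^'k::{finite,linorder}^'m"
  assumes "admissible \<tau> lam J V"
  shows "L1 \<tau> (spectral_mat lam) (spectral_point \<tau> \<Omega> (diag lam) J V) = (\<Sum>j\<in>-J. (sqrt (lam $ j) - sqrt \<tau>)\<^sup>2)"
  using assms by (intro L1_shifted spectral_point_gram) (auto simp: admissible_def)

lemma arg_min_bounded_rank_iff_first_indices:
  fixes W :: "real^'m^'n::_"
  assumes "k \<le> CARD('n)" "k \<le> CARD('m)"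
  shows "is_arg_min (L1 \<tau> (spectral_mat lam)) (\<lambda>W. W \<in> bounded_rank k) W
    \<longleftrightarrow> W ** transpose W = spectral_mat (shifted {j\<in>first_indices k. \<tau> < lam $ j})"
  using arg_min_bounded_rank_iff[where W = W and F = "first_indices k", OF first_indices_top] assms by (simp add: card_first_indices)

lemma arg_min_spectral_point_iff:
  fixes V :: "real^'k::{finite,linorder}^'m"
  assumes adm: "admissible \<tau> lam J V" and k: "CARD('k) \<le> CARD('m)"
  shows "is_arg_min (L1 \<tau> (spectral_mat lam)) (\<lambda>W. W \<in> bounded_rank CARD('k)) (spectral_point \<tau> \<Omega> (diag lam) J V)
    \<longleftrightarrow> J = first_indices CARD('k)"
proof -
  have J: "card J = CARD('k)" "\<And>j. j \<in> J \<Longrightarrow> \<tau> \<le> lam $ j" using adm by (auto simp: admissible_def)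
  have "CARD('k) \<le> CARD('n)" using J(1) by (metis card_mono finite subset_UNIV)
  from arg_min_bounded_rank_iff_first_indices[OF this k] show ?thesis
    by (simp add: spectral_point_gram[OF adm] spectral_mat_inject shifted_eq_spec_first_indices_iff[OF J])
qed

lemma arg_min_iff_spectral_point_first_indices:
  fixes W :: "real^'m^'n::_"
  assumes k: "CARD('k::{finite,linorder}) \<le> CARD('n)" "CARD('k) \<le> CARD('m)"
    and F: "\<And>j. j \<in> first_indices CARD('k) \<Longrightarrow> \<tau> \<le> lam $ j"
  shows "is_arg_min (L1 \<tau> (spectral_mat lam)) (\<lambda>W. W \<in> bounded_rank CARD('k)) W \<longleftrightarrow>
    (\<exists>V :: real^'k::_^'m. transpose V ** V = mat 1 \<and>
       W = spectral_point \<tau> \<Omega> (diag lam) (first_indices CARD('k)) V)"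
proof -
  let ?F = "first_indices CARD('k) :: 'n set"
  have c: "card ?F = CARD('k)" using k(1) by (rule card_first_indices)
  have "is_arg_min (L1 \<tau> (spectral_mat lam)) (\<lambda>W. W \<in> bounded_rank CARD('k)) W \<longleftrightarrow> W ** transpose W = spectral_mat (shifted ?F)"
    using arg_min_bounded_rank_iff_first_indices[OF k, of W] shifted_restrict[OF F] by simp
  also have "\<dots> \<longleftrightarrow> (\<exists>V :: real^'k::_^'m. transpose V ** V = mat 1 \<and> W = spectral_point \<tau> \<Omega> (diag lam) ?F V)"
  proof
    assume "W ** transpose W = spectral_mat (shifted ?F)"
    from gram_imp_spectral_point[OF c F k(2) this]
    show "\<exists>V :: real^'k::_^'m. transpose V ** V = mat 1 \<and> W = spectral_point \<tau> \<Omega> (diag lam) ?F V" .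
  next
    assume "\<exists>V :: real^'k::_^'m. transpose V ** V = mat 1 \<and> W = spectral_point \<tau> \<Omega> (diag lam) ?F V"
    then show "W ** transpose W = spectral_mat (shifted ?F)"
      using c F by (auto simp: admissible_def intro!: spectral_point_gram)
  qed
  finally show ?thesis .
qed

text \<open>The rank of a minimiser over \<open>bounded_rank k\<close> is the number of first
  indices with \<tau> < lam_j. It equals k exactly when all of them qualify, hence the condition on
  attainment.\<close>

lemma min_bounded_rank_eq_INF_fixed_rank:
  assumes k: "k \<le> CARD('n)" "k \<le> CARD('m)"
  shows "\<exists>W :: real^'m^'n::_. is_arg_min (L1 \<tau> (spectral_mat lam)) (\<lambda>W. W \<in> bounded_rank k) W \<and>
    (INF W' \<in> fixed_rank k :: (real^'m^'n::_) set. L1 \<tau> (spectral_mat lam) W') = L1 \<tau> (spectral_mat lam) W \<and>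
    ((\<forall>j\<in>first_indices k. \<tau> < lam $ j) \<longrightarrow>
      (\<exists>W' :: real^'m^'n::_. is_arg_min (L1 \<tau> (spectral_mat lam)) (\<lambda>W. W \<in> fixed_rank k) W' \<and>
         L1 \<tau> (spectral_mat lam) W' = L1 \<tau> (spectral_mat lam) W))"
proof -
  let ?F = "first_indices k :: 'n set"
  have c: "card ?F = k" using k(1) by (rule card_first_indices)
  obtain W :: "real^'m^'n::_" where W: "is_arg_min (L1 \<tau> (spectral_mat lam)) (\<lambda>W. W \<in> bounded_rank k) W"
    using L1_attains_min_bounded_rank by blast
  have inf: "(INF W' \<in> fixed_rank k :: (real^'m^'n::_) set. L1 \<tau> (spectral_mat lam) W') = L1 \<tau> (spectral_mat lam) W"
    using arg_min_bounded_rank_INF[where W = W and F = ?F, OF first_indices_top] W k(2) by (simp add: c)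
  have "is_arg_min (L1 \<tau> (spectral_mat lam)) (\<lambda>W. W \<in> fixed_rank k) W" if F: "\<forall>j\<in>?F. \<tau> < lam $ j"
  proof -
    have "{j\<in>{j\<in>?F. \<tau> < lam $ j}. lam $ j \<noteq> \<tau>} = ?F" using F by force
    moreover have "W ** transpose W = spectral_mat (shifted {j\<in>?F. \<tau> < lam $ j})"
      using W by (simp add: arg_min_bounded_rank_iff_first_indices[OF k])
    ultimately have "rank W = k" using rank_shifted c by metis
    with W show ?thesis
      by (simp add: is_arg_min_linorder fixed_rank_def bounded_rank_def)
  qed
  with W inf show ?thesis by blast
qed

end

text \<open>Carries the hypotheses on the set of eigenvalues over to \<open>lam\<close>: positivity
  directly, distinctness by counting.\<close>

lemma eigenvalues_orthogonal_diag:
  fixes \<Omega> :: "real^'n^'n"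
  assumes "orthogonal_matrix \<Omega>"
  shows "eigenvalues (\<Omega> ** diag lam ** transpose \<Omega>) = range (($) lam)"
proof -
  have O: "transpose \<Omega> ** \<Omega> = mat 1" "\<Omega> ** transpose \<Omega> = mat 1"
    using assms by (auto simp: orthogonal_matrix_def)
  show ?thesis
  proof (intro equalityI subsetI)
    fix \<mu> assume "\<mu> \<in> eigenvalues (\<Omega> ** diag lam ** transpose \<Omega>)"
    then obtain v where v: "v \<noteq> 0" "(\<Omega> ** diag lam ** transpose \<Omega>) *v v = \<mu> *s v"
      by (auto simp: eigenvalues_def)
    define x where "x = transpose \<Omega> *v v"
    have "\<Omega> *v x = (\<Omega> ** transpose \<Omega>) *v v" by (simp only: x_def matrix_vector_mul_assoc)
    then have vx: "v = \<Omega> *v x" by (simp add: O)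
    then have "x \<noteq> 0" using v(1) by auto
    then obtain i where i: "x $ i \<noteq> 0" by (auto simp: vec_eq_iff)
    have "\<Omega> *v (diag lam *v x) = \<mu> *s v"
      using v(2) by (simp only: x_def matrix_vector_mul_assoc matrix_mul_assoc)
    then have "transpose \<Omega> *v (\<Omega> *v (diag lam *v x)) = transpose \<Omega> *v (\<mu> *s v)" by simp
    also have "transpose \<Omega> *v (\<mu> *s v) = \<mu> *s x"
      by (simp only: x_def scalar_mult_eq_scaleR matrix_vector_mult_scaleR)
    also have "transpose \<Omega> *v (\<Omega> *v (diag lam *v x)) = diag lam *v x"
      by (simp only: matrix_vector_mul_assoc[of "transpose \<Omega>"] O matrix_vector_mul_lid)
    finally have "lam $ i * x $ i = \<mu> * x $ i" by (simp add: diag_vec_mult vec_eq_iff)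
    with i show "\<mu> \<in> range (($) lam)" by auto
  next
    fix \<mu> assume "\<mu> \<in> range (($) lam)"
    then obtain i where i: "\<mu> = lam $ i" by auto
    let ?v = "\<Omega> *v axis i 1"
    have t: "transpose \<Omega> *v ?v = axis i 1"
      by (simp only: matrix_vector_mul_assoc O matrix_vector_mul_lid)
    then have "?v \<noteq> 0" by (metis axis_eq_0_iff matrix_vector_mult_0_right zero_neq_one)
    moreover have "(\<Omega> ** diag lam ** transpose \<Omega>) *v ?v = \<Omega> *v (diag lam *v (transpose \<Omega> *v ?v))"
      by (simp only: matrix_vector_mul_assoc matrix_mul_assoc)
    moreover have "diag lam *v axis i 1 = \<mu> *s axis i 1"
      by (simp add: diag_vec_mult vec_eq_iff axis_def i)
    ultimately show "\<mu> \<in> eigenvalues (\<Omega> ** diag lam ** transpose \<Omega>)"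
      unfolding eigenvalues_def t
      by (auto simp: scalar_mult_eq_scaleR matrix_vector_mult_scaleR)
  qed
qed

text \<open>The fourth conjunct is conditional so that the square root in
  \<open>spectral_point\<close> exists on the first indices. The last one separates the infimum over
  rank exactly k from its attainment.\<close>

theorem theorem4p5:
  fixes \<tau> :: real
    and \<Sigma>\<^sub>0 \<Omega> :: "real^'n::{finite,linorder}^'n::_"
    and lam :: "real^'n::_"
  assumes "0 < \<tau>"
    and "transpose \<Sigma>\<^sub>0 = \<Sigma>\<^sub>0"
    and "card (eigenvalues \<Sigma>\<^sub>0) = CARD('n)"
    and "\<forall>\<mu>\<in>eigenvalues \<Sigma>\<^sub>0. 0 < \<mu>"
    and "orthogonal_matrix \<Omega>"
    and "\<Sigma>\<^sub>0 = \<Omega> ** diag lam ** transpose \<Omega>"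
    and "\<forall>i j. i \<le> j \<longrightarrow> lam $ j \<le> lam $ i"
    and "CARD('k::{finite,linorder}) \<le> min CARD('n) CARD('m::finite)"
  shows
    "(\<forall>W \<in> fixed_rank CARD('k) :: (real^'m^'n::_) set.
        critical_point_on (L1 \<tau> \<Sigma>\<^sub>0) (fixed_rank CARD('k)) W \<longleftrightarrow>
        (\<exists>J. \<exists>V :: real^'k::_^'m. admissible \<tau> lam J V \<and> W = spectral_point \<tau> \<Omega> (diag lam) J V))
   \<and> (\<forall>J. \<forall>V :: real^'k::_^'m. admissible \<tau> lam J V \<longrightarrow>
        L1 \<tau> \<Sigma>\<^sub>0 (spectral_point \<tau> \<Omega> (diag lam) J V) = (\<Sum>j\<in>-J. (sqrt (lam $ j) - sqrt \<tau>)\<^sup>2))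
   \<and> (\<forall>J. \<forall>V :: real^'k::_^'m. admissible \<tau> lam J V \<longrightarrow>
        (is_arg_min (L1 \<tau> \<Sigma>\<^sub>0) (\<lambda>W. W \<in> bounded_rank CARD('k)) (spectral_point \<tau> \<Omega> (diag lam) J V)
         \<longleftrightarrow> J = first_indices CARD('k)))
   \<and> ((\<forall>j\<in>first_indices CARD('k). \<tau> \<le> lam $ j) \<longrightarrow>
        (\<forall>W :: real^'m^'n::_.
          is_arg_min (L1 \<tau> \<Sigma>\<^sub>0) (\<lambda>W. W \<in> bounded_rank CARD('k)) W \<longleftrightarrow>
          (\<exists>V :: real^'k::_^'m. transpose V ** V = mat 1 \<and>
             W = spectral_point \<tau> \<Omega> (diag lam) (first_indices CARD('k)) V)))
   \<and> (\<exists>W :: real^'m^'n::_.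
        is_arg_min (L1 \<tau> \<Sigma>\<^sub>0) (\<lambda>W. W \<in> bounded_rank CARD('k)) W \<and>
        (INF W' \<in> fixed_rank CARD('k) :: (real^'m^'n::_) set. L1 \<tau> \<Sigma>\<^sub>0 W') = L1 \<tau> \<Sigma>\<^sub>0 W \<and>
        ((\<forall>j\<in>first_indices CARD('k). \<tau> < lam $ j) \<longrightarrow>
          (\<exists>W' :: real^'m^'n::_. is_arg_min (L1 \<tau> \<Sigma>\<^sub>0) (\<lambda>W. W \<in> fixed_rank CARD('k)) W' \<and>
                L1 \<tau> \<Sigma>\<^sub>0 W' = L1 \<tau> \<Sigma>\<^sub>0 W)))"
proof -
  have ev: "eigenvalues \<Sigma>\<^sub>0 = range (($) lam)"
    using eigenvalues_orthogonal_diag[OF assms(5)] assms(6) by simp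
  \<comment> \<open>The range of \<open>lam\<close> has as many elements as the index type, so
    \<open>lam\<close> is injective, and its weak ordering becomes strict.\<close>
  then have inj: "inj (($) lam)" using assms(3) by (simp add: eq_card_imp_inj_on)
  have pos: "0 < lam $ i" for i using assms(4) ev by auto
  have anti: "lam $ j < lam $ i" if "i < j" for i j
    using that assms(7) inj by (metis injD less_imp_le less_le less_irrefl)
  interpret ordered_spectral_bures \<tau> \<Omega> lam
    using assms(1,5) pos inj anti by unfold_locales (auto dest: injD)
  have Sig: "\<Sigma>\<^sub>0 = spectral_mat lam" by (simp add: assms(6) spectral_mat_def)
  have k: "CARD('k) \<le> CARD('n)" "CARD('k) \<le> CARD('m)" using assms(8) by auto
  show ?thesis
    unfolding Sig
    using critical_point_iff_spectral_point[OF k(2)] L1_spectral_point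
      arg_min_spectral_point_iff[OF _ k(2)] arg_min_iff_spectral_point_first_indices[OF k]
      min_bounded_rank_eq_INF_fixed_rank[OF k]
    by (intro conjI) blast+
qed

end
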